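(* Let $\delta\in(0,1)$, $i\in\{1,2\}$ and $(\alpha,h)\in\mathcal{M}^{rs}$. Then, as $n\to+\infty$, $$\frac{2S_n}{n^2}\longrightarrow u_i^*(\alpha,h)\quad\text{almost surely with respect to } \hat{\mathbb{P}}^{(i)}_{\alpha,h},$$ and $$\sqrt2\,\frac{S_n-\frac{n^2}{2}\hat m_n^{(i)}(\alpha,h)}{n}\longrightarrow\mathcal{N}(0,v_i(\alpha,h))\quad\text{in distribution with respect to } \hat{\mathbb{P}}^{(i)}_{n;\alpha,h},$$ where $\mathcal{N}(0,v_i(\alpha,h))$ is a centered Gaussian distribution with variance $$v_i(\alpha,h)=\frac{u_i^*(\alpha,h)\,[1-u_i^*(\alpha,h)]}{1-2\alpha\,[u_i^*(\alpha,h)]^2\,[1-u_i^*(\alpha,h)]}.$$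
   Context: Mean-field model. For $n\in\mathbb{N}$ let $\mathcal{E}_n$ be the edge set of the complete graph on $n$ labeled vertices (so $|\mathcal{E}_n|=\binom n2$) and $\mathcal{A}_n=\{0,1\}^{\mathcal{E}_n}$. For $\alpha,h\in\mathbb{R}$ and $x\in\mathcal{A}_n$ set $\bar{\mathcal{H}}_{n;\alpha,h}(x)=\frac{4\alpha}{3n^4}\left(\sum_{i\in\mathcal{E}_n}x_i\right)^3+h\sum_{i\in\mathcal{E}_n}x_i$. Let $\bar{\mathbb{P}}_{n;\alpha,h}$ be the probability measure on $\mathcal{A}_n$ with density $e^{\bar{\mathcal{H}}_{n;\alpha,h}(x)}/\bar Z_{n;\alpha,h}$, $\bar Z_{n;\alpha,h}=\sum_{x\in\mathcal{A}_n}e^{\bar{\mathcal{H}}_{n;\alpha,h}(x)}$, and let $S_n(x)=\sum_{i\in\mathcal{E}_n}x_i$. The quantity $2S_n/n^2$ takes values in $\Gamma_n=\{0,\frac2{n^2},\dots,1-\frac1n\}$. Let $I(u)=u\ln u+(1-u)\ln(1-u)$ on $[0,1]$ (with $0\ln 0=0$). For $\alpha>-2$ consider the scalar problem $\sup_{0\le u\le1}\left(\frac\alpha6u^3+\frac h2u-\frac12I(u)\right)$. It is known that it has a unique maximizer except when $(\alpha,h)$ lies on a critical curve $\mathcal{M}^{rs}=\{(\alpha,h):\alpha>\alpha_c,\ h<h_c,\ h=q(\alpha)\}$ ($q$ a continuous, strictly decreasing function), on which there are exactly two maximizers, denoted $u_1^*(\alpha,h)$ and $u_2^*(\alpha,h)$;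 here $(\alpha_c,h_c)=\left(\frac{27}{8},\ln2-\frac32\right)$. For $\delta\in(0,1)$, $i=1,2$, let $B_{u_i^*}=\{m\in\Gamma_n:|m-u_i^*(\alpha,h)|\le n^{-\delta}\}$ and define (for $n$ large enough that the conditioning event is non-empty) $\hat{\mathbb{P}}^{(i)}_{n;\alpha,h}(\,\cdot\,):=\bar{\mathbb{P}}_{n;\alpha,h}\left(\,\cdot\,\middle|\,\frac{2S_n}{n^2}\in B_{u_i^*}\right)$, with expectation $\hat{\mathbb{E}}^{(i)}_{n;\alpha,h}$, and $\hat m_n^{(i)}(\alpha,h):=\hat{\mathbb{E}}^{(i)}_{n;\alpha,h}\left(\frac{2S_n}{n^2}\right)$. $\hat{\mathbb{P}}^{(i)}_{\alpha,h}$ denotes any probability measure on a space on which all the $S_n$ are jointly defined and such that for each $n$ the law of $S_n$ is its law under $\hat{\mathbb{P}}^{(i)}_{n;\alpha,h}$. *)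

theory Defs
  imports "HOL-Probability.Probability"
begin

section \<open>The mean-field model\<close>

definition edges :: "nat \<Rightarrow> nat set set" where
  "edges n = {e. e \<subseteq> {..<n} \<and> card e = 2}"

definition configs :: "nat \<Rightarrow> (nat set \<Rightarrow> real) set" where
  "configs n = edges n \<rightarrow>\<^sub>E {0, 1}"

definition S :: "nat \<Rightarrow> (nat set \<Rightarrow> real) \<Rightarrow> real" where
  "S n x = (\<Sum>e\<in>edges n. x e)"

definition hamiltonian :: "nat \<Rightarrow> real \<Rightarrow> real \<Rightarrow> (nat set \<Rightarrow> real) \<Rightarrow> real" where
  "hamiltonian n \<alpha> h x = 4 * \<alpha> / (3 * real n ^ 4) * S n x ^ 3 + h * S n x"

definition partition_function :: "nat \<Rightarrow> real \<Rightarrow> real \<Rightarrow> real" where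
  "partition_function n \<alpha> h = (\<Sum>x\<in>configs n. exp (hamiltonian n \<alpha> h x))"

definition mf_measure :: "nat \<Rightarrow> real \<Rightarrow> real \<Rightarrow> (nat set \<Rightarrow> real) measure" where
  "mf_measure n \<alpha> h =
     point_measure (configs n) (\<lambda>x. ennreal (exp (hamiltonian n \<alpha> h x) / partition_function n \<alpha> h))"

definition Gamma_grid :: "nat \<Rightarrow> real set" where
  "Gamma_grid n = {2 * real k / real n ^ 2 | k. k \<le> n choose 2}"

section \<open>The scalar variational problem and the critical curve\<close>

text \<open>The convention \<open>0 ln 0 = 0\<close> holds automatically.\<close>

definition entropy_I :: "real \<Rightarrow> real" where
  "entropy_I u = u * ln u + (1 - u) * ln (1 - u)"

definition scalar_fun :: "real \<Rightarrow> real \<Rightarrow> real \<Rightarrow> real" where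
  "scalar_fun \<alpha> h u = \<alpha> / 6 * u ^ 3 + h / 2 * u - entropy_I u / 2"

definition maximizers :: "real \<Rightarrow> real \<Rightarrow> real set" where
  "maximizers \<alpha> h = {u \<in> {0..1}. \<forall>v\<in>{0..1}. scalar_fun \<alpha> h v \<le> scalar_fun \<alpha> h u}"

text \<open>
  For \<open>\<alpha> > \<alpha>_crit\<close>, \<open>q \<alpha>\<close> is the value of \<open>h\<close> at which uniqueness of the maximizer fails
  (that there is exactly one such value is not built in); for other \<open>\<alpha>\<close> it is never used.
\<close>

definition q :: "real \<Rightarrow> real" where
  "q \<alpha> = (THE h. \<not> (\<exists>!u. u \<in> maximizers \<alpha> h))"

definition \<alpha>_crit :: real where
  "\<alpha>_crit = 27 / 8"

definition h_crit :: real where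
  "h_crit = ln 2 - 3 / 2"

definition M_rs :: "(real \<times> real) set" where
  "M_rs = {(\<alpha>, h). \<alpha> > \<alpha>_crit \<and> h < h_crit \<and> h = q \<alpha>}"

text \<open>
  On the critical curve there are exactly two maximizers; they are labelled in increasing order.
\<close>

definition ustar :: "nat \<Rightarrow> real \<Rightarrow> real \<Rightarrow> real" where
  "ustar i \<alpha> h = (if i = 1 then Min (maximizers \<alpha> h) else Max (maximizers \<alpha> h))"

section \<open>Conditioning on the neighbourhood of a maximizer\<close>

definition B_nbhd :: "nat \<Rightarrow> real \<Rightarrow> nat \<Rightarrow> real \<Rightarrow> real \<Rightarrow> real set" where
  "B_nbhd i \<delta> n \<alpha> h = {m \<in> Gamma_grid n. \<bar>m - ustar i \<alpha> h\<bar> \<le> real n powr (- \<delta>)}"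

definition cond_event :: "nat \<Rightarrow> real \<Rightarrow> nat \<Rightarrow> real \<Rightarrow> real \<Rightarrow> (nat set \<Rightarrow> real) set" where
  "cond_event i \<delta> n \<alpha> h = {x \<in> configs n. 2 * S n x / real n ^ 2 \<in> B_nbhd i \<delta> n \<alpha> h}"

text \<open>
  \<open>uniform_measure M A\<close> is \<open>M\<close> conditioned on \<open>A\<close>, i.e. \<open>B \<mapsto> M (A \<inter> B) / M A\<close>; it is the null
  measure for the finitely many \<open>n\<close> whose conditioning event is empty.
\<close>

definition P_hat :: "nat \<Rightarrow> real \<Rightarrow> nat \<Rightarrow> real \<Rightarrow> real \<Rightarrow> (nat set \<Rightarrow> real) measure" where
  "P_hat i \<delta> n \<alpha> h = uniform_measure (mf_measure n \<alpha> h) (cond_event i \<delta> n \<alpha> h)"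

definition m_hat :: "nat \<Rightarrow> real \<Rightarrow> nat \<Rightarrow> real \<Rightarrow> real \<Rightarrow> real" where
  "m_hat i \<delta> n \<alpha> h = (\<integral>x. 2 * S n x / real n ^ 2 \<partial>P_hat i \<delta> n \<alpha> h)"

text \<open>
  A space \<open>M\<close> on which all the \<open>S\<^sub>n\<close> are jointly defined, as random variables \<open>T n\<close>, each with its
  law under \<open>P_hat\<close>; no assumption is made on the joint law.  The law of \<open>T n\<close> is unconstrained
  where the conditioning event is empty.
\<close>

definition joint_realization ::
  "nat \<Rightarrow> real \<Rightarrow> real \<Rightarrow> real \<Rightarrow> 'w measure \<Rightarrow> (nat \<Rightarrow> 'w \<Rightarrow> real) \<Rightarrow> bool" where
  "joint_realization i \<delta> \<alpha> h M T \<longleftrightarrow>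
     prob_space M \<and> (\<forall>n. T n \<in> borel_measurable M) \<and>
     (\<forall>n. cond_event i \<delta> n \<alpha> h \<noteq> {} \<longrightarrow>
        distr M borel (T n) = distr (P_hat i \<delta> n \<alpha> h) borel (S n))"

definition variance_v :: "nat \<Rightarrow> real \<Rightarrow> real \<Rightarrow> real" where
  "variance_v i \<alpha> h =
     ustar i \<alpha> h * (1 - ustar i \<alpha> h) / (1 - 2 * \<alpha> * (ustar i \<alpha> h)\<^sup>2 * (1 - ustar i \<alpha> h))"

end

theory Submission
  imports Defs
begin

text \<open>
  The law of the number of edges \<open>S\<close> under the conditioned model is explicit: its weight at \<open>k\<close> is the binomial
  coefficient \<open>(n choose 2) choose k\<close> times an exponential in \<open>k\<close>, restricted to the window where \<open>2 * k / n\<^sup>2\<close> is within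
  \<open>n powr - \<delta>\<close> of the maximizer \<open>u\<close>.  Almost sure convergence is immediate from this restriction, since the
  width of the window tends to 0 (\<open>strong_law_on_joint_realization\<close>).

  For the fluctuations, the logarithm of the weight is approximately \<open>n\<^sup>2 * scalar_fun \<alpha> h (2 * k / n\<^sup>2)\<close> up to terms that are
  nearly linear in the window.  Since \<open>\<alpha> > 27/8\<close>, every maximizer of the scalar problem is an interior critical
  point at which the second derivative is strictly negative (\<open>maximizer_interior\<close>, \<open>maximizer_critical\<close>,
  \<open>maximizer_nondegenerate\<close>).  Hence the second difference of the log-weight is \<open>- D / n\<^sup>2\<close> up to a factor tending to 1,
  uniformly over the window, where \<open>D = 2 / u + 2 / (1 - u) - 4 * \<alpha> * u\<close> is twice the reciprocal of the asserted variance
  (\<open>second_difference_bounds\<close>), and the first difference at \<open>k = n\<^sup>2 * u / 2\<close> is of order \<open>1 / n\<close>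
  (\<open>center_slope_limit\<close>).  Summing the differences (\<open>discrete_Taylor_upper\<close>, \<open>discrete_Taylor_lower\<close>) bounds the
  weights at distance \<open>n * s\<close> from the center above and below by functions that converge to one Gaussian function of \<open>s\<close>.

  Since \<open>\<delta> < 1\<close>, the window is much wider than \<open>n\<close> in units of \<open>k\<close>, so nothing of the Gaussian is cut off in the limit, and
  dominated convergence applied to step functions gives the limits of expectations of suitable
  functions of \<open>(S - n\<^sup>2 * u / 2) / n\<close> (\<open>Laplace_sum_limit\<close>, \<open>window_average_limit\<close>).  The limit has a nonzero mean; applying the
  result first to the identity and then to indicators of half-lines identifies the centering
  by \<open>m_hat\<close> and gives convergence of the distribution functions (\<open>central_limit_P_hat\<close>).
\<close>

section \<open>The scalar variational problem\<close>

text \<open>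
  The external field \<open>h\<close> for which \<open>u\<close> is a critical point of the scalar problem: the derivative of
  \<open>scalar_fun \<alpha> h\<close> at \<open>u\<close> is half of \<open>h - critical_field \<alpha> u\<close>.
\<close>

definition critical_field :: "real \<Rightarrow> real \<Rightarrow> real" where
  "critical_field \<alpha> u = ln u - ln (1 - u) - \<alpha> * u\<^sup>2"

lemma scalar_fun_has_derivative:
  assumes "0 < u" "u < 1"
  shows "(scalar_fun \<alpha> h has_real_derivative (h - critical_field \<alpha> u) / 2) (at u)"
proof -
  have "((\<lambda>u. u * ln u) has_real_derivative ln u + 1) (at u)"
    using assms by (auto intro!: derivative_eq_intros)
  moreover have "((\<lambda>u. (1 - u) * ln (1 - u)) has_real_derivative - ln (1 - u) - 1) (at u)"
    using assms by (auto intro!: derivative_eq_intros simp: field_simps)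
  ultimately have "((\<lambda>u. \<alpha> / 6 * u ^ 3 + h / 2 * u - (u * ln u + (1 - u) * ln (1 - u)) / 2) has_real_derivative
      \<alpha> / 6 * (3 * u\<^sup>2) + h / 2 - (ln u + 1 + (- ln (1 - u) - 1)) / 2) (at u)"
    by (intro DERIV_diff DERIV_add DERIV_cdivide) (auto intro!: derivative_eq_intros)
  then show ?thesis
    unfolding scalar_fun_def[abs_def] entropy_I_def critical_field_def
    by (rule DERIV_cong) (simp add: field_simps)
qed

text \<open>
  The sign of this derivative, i.e. whether \<open>2 * \<alpha> * (u\<^sup>2 * (1 - u))\<close> is below or above 1, decides whether
  \<open>scalar_fun \<alpha> h\<close> is concave or convex at \<open>u\<close>.
\<close>

lemma critical_field_has_derivative:
  assumes "0 < u" "u < 1"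
  shows "(critical_field \<alpha> has_real_derivative (1 - 2 * \<alpha> * (u\<^sup>2 * (1 - u))) / (u * (1 - u))) (at u)"
  unfolding critical_field_def[abs_def]
  using assms by (auto intro!: derivative_eq_intros simp: field_simps power2_eq_square power3_eq_cube)

lemma continuous_on_entropy_I: "continuous_on {0..1} entropy_I"
proof -
  have "((\<lambda>x::real. x * ln x) \<longlongrightarrow> 0) (at_right 0)"
    using tendsto_minus[OF ln_x_over_x_tendsto_0]
    by (simp add: filterlim_at_right_to_top ln_inverse divide_inverse mult.commute)
  then have z: "((\<lambda>x::real. x * ln x) \<longlongrightarrow> 0) (at 0 within {0..1})"
    by (rule tendsto_mono[rotated]) (auto simp: at_within_def intro!: le_infI2)
  have 1: "continuous_on {0..1} (\<lambda>x::real. x * ln x)"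
    unfolding continuous_on_eq_continuous_within
  proof
    fix x :: real assume "x \<in> {0..1}"
    then consider "x = 0" | "x > 0" by force
    then show "continuous (at x within {0..1}) (\<lambda>x. x * ln x)"
    proof cases
      case 1 then show ?thesis using z by (simp add: continuous_within)
    next
      case 2 then show ?thesis by (intro continuous_intros) auto
    qed
  qed
  have 2: "continuous_on {0..1} (\<lambda>x::real. (1 - x) * ln (1 - x))"
    using continuous_on_compose[OF _ continuous_on_subset[OF 1], of "{0..1}" "\<lambda>x. 1 - x"]
    by (auto simp: o_def intro!: continuous_on_op_minus)
  show ?thesis
    unfolding entropy_I_def[abs_def] by (intro continuous_on_add 1 2)
qed

lemma continuous_on_scalar_fun: "continuous_on {0..1} (scalar_fun \<alpha> h)"
  unfolding scalar_fun_def[abs_def] by (intro continuous_intros continuous_on_entropy_I) auto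

lemma maximizers_nonempty: "maximizers \<alpha> h \<noteq> {}"
proof -
  obtain u where "u \<in> {0..1}" "\<forall>v\<in>{0..1}. scalar_fun \<alpha> h v \<le> scalar_fun \<alpha> h u"
    using continuous_attains_sup[OF compact_Icc _ continuous_on_scalar_fun[of \<alpha> h]] by auto
  then show ?thesis by (auto simp: maximizers_def)
qed

text \<open>
  The slope of the entropy term is infinite at both ends of the unit interval, so a short step inwards
  from either end increases \<open>scalar_fun \<alpha> h\<close>.
\<close>

lemma maximizer_interior:
  assumes "\<alpha> > 0" "u \<in> maximizers \<alpha> h"
  shows "0 < u" "u < 1"
proof -
  have u: "0 \<le> u" "u \<le> 1" and max: "\<And>v. 0 \<le> v \<Longrightarrow> v \<le> 1 \<Longrightarrow> scalar_fun \<alpha> h v \<le> scalar_fun \<alpha> h u"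
    using assms(2) by (auto simp: maximizers_def)
  have I: "- (e * ln e) \<le> - entropy_I e" if "0 < e" "e < 1" for e :: real
  proof -
    have "(1 - e) * ln (1 - e) \<le> 0" using that by (intro mult_nonneg_nonpos) auto
    then show ?thesis by (simp add: entropy_I_def)
  qed
  have "u \<noteq> 0"
  proof
    assume "u = 0"
    \<comment> \<open>small enough that the entropy gain \<open>- e * ln e / 2\<close> outweighs the field term \<open>h * e / 2\<close>\<close>
    define e where "e = exp (- \<bar>h\<bar> - 1)"
    have e: "0 < e" "e < 1" by (auto simp: e_def)
    have "h - ln e > 0" by (simp add: e_def)
    then have "0 < e * (h - ln e)" using e by (intro mult_pos_pos)
    moreover have "0 < \<alpha> / 6 * e ^ 3" using e assms(1) by simp
    ultimately have "0 < \<alpha> / 6 * e ^ 3 + h / 2 * e - e * ln e / 2"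
      by (simp add: right_diff_distrib mult.commute)
    also have "\<dots> \<le> scalar_fun \<alpha> h e"
      using I[OF e] by (simp add: scalar_fun_def)
    also have "\<dots> \<le> scalar_fun \<alpha> h 0" using max[of e] e \<open>u = 0\<close> by simp
    finally show False by (simp add: scalar_fun_def entropy_I_def)
  qed
  moreover have "u \<noteq> 1"
  proof
    assume "u = 1"
    \<comment> \<open>here the entropy gain also has to pay for the loss of at most \<open>\<alpha> * e / 2\<close> in the cubic term\<close>
    define e where "e = exp (- \<alpha> - \<bar>h\<bar> - 1)"
    have e: "0 < e" "e < 1" using assms(1) by (auto simp: e_def)
    have "- \<alpha> - h - ln e > 0" by (simp add: e_def)
    then have "0 < e * (- \<alpha> - h - ln e)" using e by (intro mult_pos_pos)
    then have "0 < - (e * \<alpha>) - e * h - e * ln e" by (simp add: right_diff_distrib)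
    moreover have "\<alpha> / 6 * (1 - 3 * e) \<le> \<alpha> / 6 * (1 - e) ^ 3"
    proof (rule mult_left_mono)
      have "(1 - e) ^ 3 - (1 - 3 * e) = e\<^sup>2 * (3 - e)"
        by (simp add: power2_eq_square power3_eq_cube algebra_simps)
      also have "\<dots> \<ge> 0" using e by simp
      finally show "1 - 3 * e \<le> (1 - e) ^ 3" by simp
    qed (use assms(1) in auto)
    moreover have "entropy_I (1 - e) = entropy_I e" by (simp add: entropy_I_def)
    ultimately have "scalar_fun \<alpha> h 1 < scalar_fun \<alpha> h (1 - e)"
      using I[OF e] by (simp add: scalar_fun_def entropy_I_def[of 1] right_diff_distrib mult.commute diff_divide_distrib)
    then show False using max[of "1 - e"] e \<open>u = 1\<close> by simp
  qed
  ultimately show "0 < u" "u < 1" using u by auto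
qed

lemma maximizer_critical:
  assumes "\<alpha> > 0" "u \<in> maximizers \<alpha> h"
  shows "critical_field \<alpha> u = h"
proof -
  note u = maximizer_interior[OF assms]
  have "(h - critical_field \<alpha> u) / 2 = 0"
  proof (rule DERIV_local_max[OF scalar_fun_has_derivative[OF u]])
    show "0 < min u (1 - u)" using u by simp
    show "\<forall>y. \<bar>u - y\<bar> < min u (1 - u) \<longrightarrow> scalar_fun \<alpha> h y \<le> scalar_fun \<alpha> h u"
      using assms(2) by (auto simp: maximizers_def abs_real_def split: if_splits)
  qed
  then show ?thesis by simp
qed

lemma cubic_has_derivative:
  "((\<lambda>u::real. u\<^sup>2 * (1 - u)) has_real_derivative x * (2 - 3 * x)) (at x)"
proof -
  have "((\<lambda>u. u\<^sup>2 * (1 - u)) has_real_derivative (2 * x) * (1 - x) + x\<^sup>2 * (- 1)) (at x)"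
    by (auto intro!: derivative_eq_intros)
  moreover have "(2 * x) * (1 - x) + x\<^sup>2 * (- 1) = x * (2 - 3 * x)"
    by (simp add: power2_eq_square algebra_simps)
  ultimately show ?thesis by simp
qed

lemma cubic_strict_mono_left:
  fixes u v :: real
  assumes "0 \<le> u" "u < v" "v \<le> 2/3"
  shows "u\<^sup>2 * (1 - u) < v\<^sup>2 * (1 - v)"
proof (rule DERIV_pos_imp_increasing_open[OF assms(2)])
  fix x assume "u < x" "x < v"
  then show "\<exists>y. DERIV (\<lambda>u. u\<^sup>2 * (1 - u)) x :> y \<and> y > 0"
    using assms by (intro exI[of _ "x * (2 - 3 * x)"] conjI cubic_has_derivative mult_pos_pos) auto
qed (intro continuous_intros)

lemma cubic_strict_antimono_right:
  fixes u v :: real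
  assumes "2/3 \<le> u" "u < v"
  shows "v\<^sup>2 * (1 - v) < u\<^sup>2 * (1 - u)"
proof (rule DERIV_neg_imp_decreasing_open[OF assms(2)])
  fix x assume "u < x" "x < v"
  then have "x * (2 - 3 * x) < 0" using assms by (intro mult_pos_neg) auto
  then show "\<exists>y. DERIV (\<lambda>u. u\<^sup>2 * (1 - u)) x :> y \<and> y < 0"
    by (intro exI[of _ "x * (2 - 3 * x)"] conjI cubic_has_derivative)
qed (intro continuous_intros)

lemma critical_field_mono:
  assumes "0 < a" "a < b" "b < 1" "\<And>x. a < x \<Longrightarrow> x < b \<Longrightarrow> 2 * \<alpha> * (x\<^sup>2 * (1 - x)) < 1"
  shows "critical_field \<alpha> a < critical_field \<alpha> b"
proof (rule DERIV_pos_imp_increasing_open[OF assms(2)])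
  fix x assume "a < x" "x < b"
  then show "\<exists>y. DERIV (critical_field \<alpha>) x :> y \<and> y > 0"
    using assms(1-3) assms(4)[of x]
    by (intro exI[of _ "(1 - 2 * \<alpha> * (x\<^sup>2 * (1 - x))) / (x * (1 - x))"] conjI critical_field_has_derivative) auto
next
  show "continuous_on {a..b} (critical_field \<alpha>)"
    using assms unfolding critical_field_def[abs_def] by (intro continuous_intros) auto
qed

lemma critical_field_antimono:
  assumes "0 < a" "a < b" "b < 1" "\<And>x. a < x \<Longrightarrow> x < b \<Longrightarrow> 2 * \<alpha> * (x\<^sup>2 * (1 - x)) > 1"
  shows "critical_field \<alpha> b < critical_field \<alpha> a"
proof (rule DERIV_neg_imp_decreasing_open[OF assms(2)])
  fix x assume "a < x" "x < b"
  then show "\<exists>y. DERIV (critical_field \<alpha>) x :> y \<and> y < 0"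
    using assms(1-3) assms(4)[of x]
    by (intro exI[of _ "(1 - 2 * \<alpha> * (x\<^sup>2 * (1 - x))) / (x * (1 - x))"] conjI critical_field_has_derivative)
      (auto intro!: divide_neg_pos)
next
  show "continuous_on {a..b} (critical_field \<alpha>)"
    using assms unfolding critical_field_def[abs_def] by (intro continuous_intros) auto
qed

text \<open>
  If \<open>scalar_fun \<alpha> h\<close> is strictly convex on an interval and one end is a critical point, then the function
  strictly increases from this end towards the other one.  Unlike the second derivative test this
  also excludes inflection points.
\<close>

lemma no_maximizer_at_end_of_convex_stretch:
  assumes "\<alpha> > 0" "0 < a" "a < b" "b < 1"
    and convex: "\<And>x. a < x \<Longrightarrow> x < b \<Longrightarrow> 2 * \<alpha> * (x\<^sup>2 * (1 - x)) > 1"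
  shows "a \<notin> maximizers \<alpha> h" "b \<notin> maximizers \<alpha> h"
proof -
  have ca: "continuous_on {a..b} (scalar_fun \<alpha> h)"
    by (rule continuous_on_subset[OF continuous_on_scalar_fun]) (use assms in auto)
  show "a \<notin> maximizers \<alpha> h"
  proof
    assume m: "a \<in> maximizers \<alpha> h"
    have "scalar_fun \<alpha> h a < scalar_fun \<alpha> h b"
    proof (rule DERIV_pos_imp_increasing_open[OF assms(3) _ ca])
      fix x assume x: "a < x" "x < b"
      have "critical_field \<alpha> x < h"
        using critical_field_antimono[of a x \<alpha>] assms x maximizer_critical[OF assms(1) m] by force
      then show "\<exists>y. DERIV (scalar_fun \<alpha> h) x :> y \<and> y > 0"
        using assms(2-4) x
        by (intro exI[of _ "(h - critical_field \<alpha> x) / 2"] conjI scalar_fun_has_derivative) auto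
    qed
    moreover have "scalar_fun \<alpha> h b \<le> scalar_fun \<alpha> h a"
      using m assms(2-4) by (auto simp: maximizers_def)
    ultimately show False by simp
  qed
  show "b \<notin> maximizers \<alpha> h"
  proof
    assume m: "b \<in> maximizers \<alpha> h"
    have "scalar_fun \<alpha> h b < scalar_fun \<alpha> h a"
    proof (rule DERIV_neg_imp_decreasing_open[OF assms(3) _ ca])
      fix x assume x: "a < x" "x < b"
      have "critical_field \<alpha> x > h"
        using critical_field_antimono[of x b \<alpha>] assms x maximizer_critical[OF assms(1) m] by force
      then show "\<exists>y. DERIV (scalar_fun \<alpha> h) x :> y \<and> y < 0"
        using assms(2-4) x
        by (intro exI[of _ "(h - critical_field \<alpha> x) / 2"] conjI scalar_fun_has_derivative) auto
    qed
    moreover have "scalar_fun \<alpha> h a \<le> scalar_fun \<alpha> h b"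
      using m assms(2-4) by (auto simp: maximizers_def)
    ultimately show False by simp
  qed
qed

text \<open>
  The function \<open>u\<^sup>2 * (1 - u)\<close> increases up to \<open>2/3\<close>, where it has the value \<open>4/27\<close>, and decreases afterwards.
  Since \<open>2 * \<alpha> * 4/27 > 1\<close> for \<open>\<alpha> > 27/8\<close>, the points where \<open>scalar_fun \<alpha> h\<close> fails to be strictly concave form
  an interval around \<open>2/3\<close>, and each of them is the end of a stretch of strict convexity.
\<close>

lemma maximizer_nondegenerate:
  assumes \<alpha>: "\<alpha> > 27/8" and m: "u \<in> maximizers \<alpha> h"
  shows "2 * \<alpha> * (u\<^sup>2 * (1 - u)) < 1"
proof (rule ccontr)
  assume "\<not> ?thesis"
  then have ge: "2 * \<alpha> * (u\<^sup>2 * (1 - u)) \<ge> 1" by simp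
  have pos: "\<alpha> > 0" using \<alpha> by simp
  note u = maximizer_interior[OF pos m]
  show False
  proof (cases "u > 2/3")
    case True
    show False
    proof (rule no_maximizer_at_end_of_convex_stretch(2)[OF pos _ True u(2), THEN notE, OF _ _ m])
      fix x assume "2/3 < x" "x < u"
      then show "1 < 2 * \<alpha> * (x\<^sup>2 * (1 - x))"
        using cubic_strict_antimono_right[of x u] pos ge
        by (intro order_le_less_trans[OF ge]) auto
    qed auto
  next
    case False
    \<comment> \<open>the point \<open>u\<close> may be \<open>2/3\<close> itself, so the convex stretch has to be extended beyond \<open>2/3\<close>\<close>
    have "isCont (\<lambda>x. 2 * \<alpha> * (x\<^sup>2 * (1 - x))) (2/3)" by (intro continuous_intros)
    then have "((\<lambda>x. 2 * \<alpha> * (x\<^sup>2 * (1 - x))) \<longlongrightarrow> 2 * \<alpha> * ((2/3)\<^sup>2 * (1 - 2/3))) (at_right (2/3))"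
      by (simp add: isCont_def filterlim_at_split)
    moreover have "2 * \<alpha> * ((2/3)\<^sup>2 * (1 - 2/3)) > 1" using \<alpha> by (simp add: power2_eq_square)
    ultimately have "eventually (\<lambda>x. 2 * \<alpha> * (x\<^sup>2 * (1 - x)) > 1) (at_right (2/3))"
      by (rule order_tendstoD)
    then obtain c where c: "c > 2/3" "\<And>x. 2/3 < x \<Longrightarrow> x < c \<Longrightarrow> 2 * \<alpha> * (x\<^sup>2 * (1 - x)) > 1"
      by (auto simp: eventually_at_right_field)
    \<comment> \<open>any cap strictly between \<open>2/3\<close> and 1 keeps \<open>b\<close> inside the unit interval\<close>
    define b where "b = min c (5/6)"
    have b: "b > 2/3" "b < 1" "b \<le> c" using c(1) by (auto simp: b_def)
    show False
    proof (rule no_maximizer_at_end_of_convex_stretch(1)[OF pos u(1) _ b(2), THEN notE, OF _ _ m])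
      show "u < b" using False b by simp
      fix x assume x: "u < x" "x < b"
      show "1 < 2 * \<alpha> * (x\<^sup>2 * (1 - x))"
      proof (cases "x \<le> 2/3")
        case True
        then show ?thesis using cubic_strict_mono_left[of u x] x u pos
          by (intro order_le_less_trans[OF ge]) auto
      qed (use c b x in auto)
    qed
  qed
qed

text \<open>
  Two maximizers on the same side of \<open>2/3\<close> would bound an interval of strict concavity, on which
  \<open>critical_field\<close> is injective; but both of them have the critical field \<open>h\<close>.  Finiteness makes the minimum and
  the maximum in the definition of \<open>ustar\<close> meaningful.
\<close>

lemma finite_maximizers:
  assumes "\<alpha> > 27/8"
  shows "finite (maximizers \<alpha> h)"
proof -
  have pos: "\<alpha> > 0" using assms by simp
  have no: False
    if m: "a \<in> maximizers \<alpha> h" "b \<in> maximizers \<alpha> h" and ab: "a < b" and side: "b \<le> 2/3 \<or> 2/3 \<le> a" for a b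
  proof -
    have "critical_field \<alpha> a < critical_field \<alpha> b"
    proof (rule critical_field_mono[OF maximizer_interior(1)[OF pos m(1)] ab maximizer_interior(2)[OF pos m(2)]])
      fix x assume x: "a < x" "x < b"
      show "2 * \<alpha> * (x\<^sup>2 * (1 - x)) < 1"
        using side
      proof
        assume "b \<le> 2/3"
        then have "x\<^sup>2 * (1 - x) < b\<^sup>2 * (1 - b)"
          using x maximizer_interior(1)[OF pos m(1)] by (intro cubic_strict_mono_left) auto
        then show ?thesis using pos
          by (intro order_less_trans[OF _ maximizer_nondegenerate[OF assms m(2)]]) auto
      next
        assume "2/3 \<le> a"
        then have "x\<^sup>2 * (1 - x) < a\<^sup>2 * (1 - a)"
          using x by (intro cubic_strict_antimono_right) auto
        then show ?thesis using pos
          by (intro order_less_trans[OF _ maximizer_nondegenerate[OF assms m(1)]]) auto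
      qed
    qed
    then show False using maximizer_critical[OF pos] m by simp
  qed
  have fin: "finite A" if one: "\<And>a b. a \<in> A \<Longrightarrow> b \<in> A \<Longrightarrow> a < b \<Longrightarrow> False" for A :: "real set"
  proof (cases "A = {}")
    case False
    then obtain a where a: "a \<in> A" by auto
    have "b = a" if "b \<in> A" for b
      using one[of a b] one[of b a] a that by (cases a b rule: linorder_cases) auto
    then have "A \<subseteq> {a}" by auto
    then show ?thesis by (rule finite_subset) simp
  qed simp
  have "finite (maximizers \<alpha> h \<inter> {..2/3})" "finite (maximizers \<alpha> h \<inter> {2/3..})"
    by (rule fin, insert no, auto)+
  then have "finite (maximizers \<alpha> h \<inter> {..2/3} \<union> maximizers \<alpha> h \<inter> {2/3..})"
    by simp
  then show ?thesis
    by (rule rev_finite_subset) auto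
qed

lemma ustar_in_maximizers:
  assumes "\<alpha> > 27/8"
  shows "ustar i \<alpha> h \<in> maximizers \<alpha> h"
  using Min_in[OF finite_maximizers[OF assms] maximizers_nonempty]
    Max_in[OF finite_maximizers[OF assms] maximizers_nonempty]
  by (simp add: ustar_def)

section \<open>The conditional law of the number of edges\<close>

text \<open>
  A 0-1 vector is the indicator of a subset; group the subsets by cardinality.
\<close>

lemma sum_Boolean_cube:
  fixes g :: "real \<Rightarrow> real"
  assumes "finite E"
  shows "(\<Sum>x\<in>E \<rightarrow>\<^sub>E {0, 1}. g (\<Sum>e\<in>E. x e)) = (\<Sum>k\<le>card E. real (card E choose k) * g (real k))"
proof -
  have "bij_betw (\<lambda>A. restrict (indicator A) E) (Pow E) (E \<rightarrow>\<^sub>E {0, 1::real})"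
    by (rule bij_betw_byWitness[where f' = "\<lambda>x. {e \<in> E. x e = 1}"])
      (auto simp: fun_eq_iff indicator_def PiE_def extensional_def Pi_def split: if_splits)
  then have "(\<Sum>x\<in>E \<rightarrow>\<^sub>E {0, 1}. g (\<Sum>e\<in>E. x e)) =
      (\<Sum>A\<in>Pow E. g (\<Sum>e\<in>E. restrict (indicator A) E e))"
    by (rule sum.reindex_bij_betw[symmetric])
  also have "\<dots> = (\<Sum>A\<in>Pow E. g (real (card A)))"
  proof (rule sum.cong[OF refl])
    fix A assume A: "A \<in> Pow E"
    have "(\<Sum>e\<in>E. restrict (indicator A) E e) = (\<Sum>e\<in>E. indicator A e :: real)"
      by (rule sum.cong) auto
    also have "\<dots> = real (card A)"
      using A assms by (simp add: indicator_def of_bool_def sum.If_cases Int_absorb1)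
    finally show "g (\<Sum>e\<in>E. restrict (indicator A) E e) = g (real (card A))" by simp
  qed
  also have "\<dots> = (\<Sum>k\<le>card E. \<Sum>A\<in>{A \<in> Pow E. card A = k}. g (real (card A)))"
    by (rule sum.group[symmetric]) (use assms in \<open>auto intro: card_mono\<close>)
  also have "\<dots> = (\<Sum>k\<le>card E. real (card E choose k) * g (real k))"
    using n_subsets[OF assms] by (intro sum.cong refl) auto
  finally show ?thesis .
qed

lemma finite_edges: "finite (edges n)" and card_edges: "card (edges n) = n choose 2"
  using n_subsets[of "{..<n}" 2] by (auto simp: edges_def intro: finite_subset[of _ "Pow {..<n}"])

lemma finite_configs: "finite (configs n)"
  unfolding configs_def by (intro finite_PiE finite_edges) auto

lemma S_config_nat:
  assumes "x \<in> configs n"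
  obtains k where "k \<le> n choose 2" "S n x = real k"
proof
  have 01: "x e = of_bool (x e = 1)" if "e \<in> edges n" for e
    using assms that by (auto simp: configs_def PiE_iff)
  have "S n x = (\<Sum>e\<in>edges n. of_bool (x e = 1))"
    unfolding S_def using 01 by (rule sum.cong[OF refl])
  also have "\<dots> = real (card {e \<in> edges n. x e = 1})"
    using finite_edges by (simp add: of_bool_def sum.If_cases Int_def)
  finally show "S n x = real (card {e \<in> edges n. x e = 1})" .
  show "card {e \<in> edges n. x e = 1} \<le> n choose 2"
    unfolding card_edges[symmetric] by (intro card_mono finite_edges) auto
qed

lemma cond_event_eq:
  "cond_event i \<delta> n \<alpha> h =
    {x \<in> configs n. \<bar>2 * S n x / real n ^ 2 - ustar i \<alpha> h\<bar> \<le> real n powr (- \<delta>)}"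
  unfolding cond_event_def B_nbhd_def Gamma_grid_def by (auto dest: S_config_nat)

lemma uniform_measure_point_measure:
  fixes p :: "'a \<Rightarrow> real"
  assumes "finite A" "B \<subseteq> A" "\<And>x. x \<in> A \<Longrightarrow> p x \<ge> 0" "sum p B > 0"
  shows "uniform_measure (point_measure A (\<lambda>x. ennreal (p x))) B =
    point_measure A (\<lambda>x. ennreal (indicator B x * p x / sum p B))"
proof -
  have "emeasure (point_measure A (\<lambda>x. ennreal (p x))) B = ennreal (sum p B)"
    using assms by (subst emeasure_point_measure_finite) (auto intro!: sum_ennreal)
  moreover have "ennreal (p x) * (indicator B x / ennreal (sum p B)) =
      ennreal (indicator B x * p x / sum p B)" if "x \<in> A" for x
    using assms that
    by (auto simp: indicator_def divide_ennreal[symmetric] ennreal_times_divide)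
  ultimately show ?thesis
    unfolding uniform_measure_def point_measure_def
    by (subst density_density_eq) (auto intro!: density_cong simp: AE_count_space)
qed

text \<open>
  The unnormalised probability of having \<open>k\<close> edges.
\<close>

definition weight :: "nat \<Rightarrow> real \<Rightarrow> real \<Rightarrow> nat \<Rightarrow> real" where
  "weight n \<alpha> h k =
    real ((n choose 2) choose k) * exp (4 * \<alpha> / (3 * real n ^ 4) * real k ^ 3 + h * real k)"

definition window :: "nat \<Rightarrow> real \<Rightarrow> real \<Rightarrow> nat set" where
  "window n \<delta> u = {k. k \<le> n choose 2 \<and> \<bar>2 * real k / real n ^ 2 - u\<bar> \<le> real n powr (- \<delta>)}"

lemma finite_window: "finite (window n \<delta> u)"
  by (rule finite_subset[of _ "{..n choose 2}"]) (auto simp: window_def)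

lemma weight_pos: "k \<in> window n \<delta> u \<Longrightarrow> weight n \<alpha> h k > 0"
  by (simp add: weight_def window_def)

text \<open>
  The Hamiltonian and the conditioning depend on a configuration only through its number of edges,
  which reduces the conditioned model to a probability vector on an interval of integers.
\<close>

lemma sum_cond_event:
  "(\<Sum>x\<in>cond_event i \<delta> n \<alpha> h. exp (hamiltonian n \<alpha> h x) * g (S n x)) =
    (\<Sum>k\<in>window n \<delta> (ustar i \<alpha> h). weight n \<alpha> h k * g (real k))"
proof -
  let ?P = "\<lambda>s. \<bar>2 * s / real n ^ 2 - ustar i \<alpha> h\<bar> \<le> real n powr (- \<delta>)"
  let ?G = "\<lambda>s. exp (4 * \<alpha> / (3 * real n ^ 4) * s ^ 3 + h * s) * g s"
  have "(\<Sum>x\<in>cond_event i \<delta> n \<alpha> h. exp (hamiltonian n \<alpha> h x) * g (S n x)) =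
      (\<Sum>x\<in>configs n. if ?P (S n x) then ?G (S n x) else 0)"
    unfolding cond_event_eq sum.inter_filter[OF finite_configs, symmetric]
    by (simp add: hamiltonian_def)
  also have "\<dots> = (\<Sum>k\<le>n choose 2. real ((n choose 2) choose k) * (if ?P (real k) then ?G (real k) else 0))"
    unfolding configs_def S_def
    using sum_Boolean_cube[OF finite_edges[of n], of "\<lambda>s. if ?P s then ?G s else 0"]
    by (simp add: card_edges)
  also have "\<dots> = (\<Sum>k\<le>n choose 2. if ?P (real k) then weight n \<alpha> h k * g (real k) else 0)"
    by (intro sum.cong) (auto simp: weight_def)
  also have "\<dots> = (\<Sum>k\<in>{k\<in>{..n choose 2}. ?P (real k)}. weight n \<alpha> h k * g (real k))"
    by (rule sum.inter_filter[symmetric]) simp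
  also have "{k\<in>{..n choose 2}. ?P (real k)} = window n \<delta> (ustar i \<alpha> h)"
    by (auto simp: window_def)
  finally show ?thesis .
qed

lemma P_hat_eq_point_measure:
  assumes "cond_event i \<delta> n \<alpha> h \<noteq> {}"
  shows "P_hat i \<delta> n \<alpha> h = point_measure (configs n)
    (\<lambda>x. ennreal (indicator (cond_event i \<delta> n \<alpha> h) x * exp (hamiltonian n \<alpha> h x) /
      (\<Sum>x\<in>cond_event i \<delta> n \<alpha> h. exp (hamiltonian n \<alpha> h x))))"
proof -
  let ?B = "cond_event i \<delta> n \<alpha> h" and ?e = "\<lambda>x. exp (hamiltonian n \<alpha> h x)"
  let ?Z = "partition_function n \<alpha> h"
  have B: "?B \<subseteq> configs n" by (auto simp: cond_event_def)
  have Z: "?Z > 0" unfolding partition_function_def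
    using assms B finite_configs by (intro sum_pos) auto
  have sB: "(\<Sum>x\<in>?B. ?e x) > 0"
    using assms finite_subset[OF B finite_configs] by (intro sum_pos) auto
  have s: "(\<Sum>x\<in>?B. ?e x / ?Z) = (\<Sum>x\<in>?B. ?e x) / ?Z" by (simp add: sum_divide_distrib)
  have "P_hat i \<delta> n \<alpha> h = point_measure (configs n)
      (\<lambda>x. ennreal (indicator ?B x * (?e x / ?Z) / (\<Sum>x\<in>?B. ?e x / ?Z)))"
    unfolding P_hat_def mf_measure_def
    by (rule uniform_measure_point_measure[OF finite_configs B]) (use Z sB s in auto)
  also have "\<dots> = point_measure (configs n) (\<lambda>x. ennreal (indicator ?B x * ?e x / (\<Sum>x\<in>?B. ?e x)))"
    using Z by (simp add: s)
  finally show ?thesis .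
qed

lemma prob_space_P_hat:
  assumes "cond_event i \<delta> n \<alpha> h \<noteq> {}"
  shows "prob_space (P_hat i \<delta> n \<alpha> h)"
proof
  let ?B = "cond_event i \<delta> n \<alpha> h" and ?e = "\<lambda>x. exp (hamiltonian n \<alpha> h x)"
  have B: "?B \<subseteq> configs n" by (auto simp: cond_event_def)
  have sB: "(\<Sum>x\<in>?B. ?e x) > 0"
    using assms finite_subset[OF B finite_configs] by (intro sum_pos) auto
  have "(\<Sum>x\<in>configs n. indicator ?B x * ?e x) = (\<Sum>x\<in>?B. ?e x)"
    using B finite_configs by (intro sum.mono_neutral_cong_right) auto
  then have "(\<Sum>x\<in>configs n. indicator ?B x * ?e x / (\<Sum>x\<in>?B. ?e x)) = 1"
    using sB by (simp add: sum_divide_distrib[symmetric])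
  then show "emeasure (P_hat i \<delta> n \<alpha> h) (space (P_hat i \<delta> n \<alpha> h)) = 1"
    unfolding P_hat_eq_point_measure[OF assms] space_point_measure
    using sB by (subst emeasure_point_measure_finite[OF finite_configs])
      (simp_all add: sum_ennreal divide_nonneg_pos)
qed

lemma integral_P_hat:
  fixes g :: "real \<Rightarrow> real"
  assumes "cond_event i \<delta> n \<alpha> h \<noteq> {}"
  shows "(\<integral>x. g (S n x) \<partial>P_hat i \<delta> n \<alpha> h) =
    (\<Sum>k\<in>window n \<delta> (ustar i \<alpha> h). weight n \<alpha> h k * g (real k)) /
    (\<Sum>k\<in>window n \<delta> (ustar i \<alpha> h). weight n \<alpha> h k)"
proof -
  let ?B = "cond_event i \<delta> n \<alpha> h" and ?e = "\<lambda>x. exp (hamiltonian n \<alpha> h x)"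
  have B: "?B \<subseteq> configs n" by (auto simp: cond_event_def)
  have sB: "(\<Sum>x\<in>?B. ?e x) \<ge> 0" by (intro sum_nonneg) auto
  have "(\<integral>x. g (S n x) \<partial>P_hat i \<delta> n \<alpha> h) =
      (\<Sum>x\<in>configs n. indicator ?B x * ?e x / (\<Sum>x\<in>?B. ?e x) * g (S n x))"
    unfolding P_hat_eq_point_measure[OF assms]
    using sB by (subst lebesgue_integral_point_measure_finite[OF finite_configs]) auto
  also have "\<dots> = (\<Sum>x\<in>?B. ?e x * g (S n x) / (\<Sum>x\<in>?B. ?e x))"
    using B finite_configs by (intro sum.mono_neutral_cong_right) auto
  also have "\<dots> = (\<Sum>x\<in>?B. ?e x * g (S n x)) / (\<Sum>x\<in>?B. ?e x)"
    by (simp add: sum_divide_distrib)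
  finally show ?thesis
    using sum_cond_event[where g = g and i = i and n = n and \<alpha> = \<alpha> and h = h and \<delta> = \<delta>]
      sum_cond_event[where g = "\<lambda>_. 1" and i = i and n = n and \<alpha> = \<alpha> and h = h and \<delta> = \<delta>] by simp
qed

section \<open>Second order bounds for sequences and Laplace's method for sums\<close>

text \<open>
  The discrete form of a concave function lying below its tangent, here the zero function: the increments
  are decreasing and vanish at \<open>c\<close>, so they are nonpositive to the right of \<open>c\<close> and nonnegative to the left.
\<close>

lemma discrete_concave_nonpos:
  fixes g :: "nat \<Rightarrow> real"
  assumes "lo \<le> c" "c < hi" "g c = 0" "g (Suc c) = 0"
    and concave: "\<And>k. lo \<le> k \<Longrightarrow> Suc (Suc k) \<le> hi \<Longrightarrow> g (Suc (Suc k)) - 2 * g (Suc k) + g k \<le> 0"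
    and "lo \<le> k" "k \<le> hi"
  shows "g k \<le> 0"
proof (cases "c \<le> k")
  case True
  have step: "g (Suc l) - g l \<le> 0" if "c \<le> l" "l < hi" for l
    using that
  proof (induction rule: dec_induct)
    case (step m)
    then show ?case using concave[of m] assms(1) by simp
  qed (use assms in simp)
  show ?thesis using True \<open>k \<le> hi\<close>
  proof (induction rule: dec_induct)
    case (step m)
    then show ?case using \<open>\<And>l. c \<le> l \<Longrightarrow> l < hi \<Longrightarrow> g (Suc l) - g l \<le> 0\<close>[of m] by simp
  qed (use assms in simp)
next
  case False
  then have "k \<le> c" by simp
  have step: "g l \<le> g (Suc l)" if "l \<le> c" "lo \<le> l" for l
    using that
  proof (induction rule: inc_induct)
    case (step m)
    then show ?case using concave[of m] assms(2) by simp
  qed (use assms in simp)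
  show ?thesis using \<open>k \<le> c\<close> \<open>lo \<le> k\<close>
  proof (induction rule: inc_induct)
    case (step m)
    then show ?case using \<open>\<And>l. l \<le> c \<Longrightarrow> lo \<le> l \<Longrightarrow> g l \<le> g (Suc l)\<close>[of m] by simp
  qed (use assms in simp)
qed

text \<open>
  A second order Taylor bound for sequences.  The quadratic remainder involves \<open>j * (j - 1)\<close> rather than \<open>j\<^sup>2\<close>
  because the slope at \<open>c\<close> is measured by the forward difference; this product has second difference 2 and is
  nonnegative for every integer \<open>j\<close>.
\<close>

lemma discrete_Taylor_upper:
  fixes f :: "nat \<Rightarrow> real"
  assumes "lo \<le> c" "c < hi" "lo \<le> k" "k \<le> hi"
    and curv: "\<And>k. lo \<le> k \<Longrightarrow> Suc (Suc k) \<le> hi \<Longrightarrow> f (Suc (Suc k)) - 2 * f (Suc k) + f k \<le> - a"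
  shows "f k \<le> f c + (real k - real c) * (f (Suc c) - f c)
    - a * ((real k - real c) * (real k - real c - 1) / 2)"
proof -
  define g where "g k = f k - f c - (real k - real c) * (f (Suc c) - f c)
    + a * ((real k - real c) * (real k - real c - 1) / 2)" for k
  have "g k \<le> 0"
  proof (rule discrete_concave_nonpos[of lo c hi g])
    fix l assume "lo \<le> l" "Suc (Suc l) \<le> hi"
    moreover have "g (Suc (Suc l)) - 2 * g (Suc l) + g l = f (Suc (Suc l)) - 2 * f (Suc l) + f l + a"
      by (simp add: g_def field_simps)
    ultimately show "g (Suc (Suc l)) - 2 * g (Suc l) + g l \<le> 0" using curv[of l] by simp
  qed (use assms in \<open>auto simp: g_def\<close>)
  then show ?thesis by (simp add: g_def)
qed

lemma discrete_Taylor_lower: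
  fixes f :: "nat \<Rightarrow> real"
  assumes "lo \<le> c" "c < hi" "lo \<le> k" "k \<le> hi"
    and curv: "\<And>k. lo \<le> k \<Longrightarrow> Suc (Suc k) \<le> hi \<Longrightarrow> - a \<le> f (Suc (Suc k)) - 2 * f (Suc k) + f k"
  shows "f c + (real k - real c) * (f (Suc c) - f c)
    - a * ((real k - real c) * (real k - real c - 1) / 2) \<le> f k"
proof -
  have "- f k \<le> - f c + (real k - real c) * (- f (Suc c) - - f c)
      - - a * ((real k - real c) * (real k - real c - 1) / 2)"
    by (rule discrete_Taylor_upper[OF assms(1-4)]) (use curv in force)
  moreover have "(real k - real c) * (- f (Suc c) - - f c) = - ((real k - real c) * (f (Suc c) - f c))"
    by (simp add: algebra_simps)
  ultimately show ?thesis by linarith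
qed

text \<open>
  The lattice point reached when the scaled displacement \<open>s\<close> from \<open>c\<close> is rounded down to mesh \<open>1 / n\<close>.  It turns a
  sum over lattice points into the integral of a step function.  Negative positions are truncated to 0, so
  index sets are required not to contain 0 below.
\<close>

definition cell :: "nat \<Rightarrow> nat \<Rightarrow> real \<Rightarrow> nat" where
  "cell n c s = nat \<lfloor>real c + real n * s\<rfloor>"

lemma cell_eq_iff:
  assumes "n > 0" "k > 0"
  shows "cell n c s = k \<longleftrightarrow> s \<in> {(real k - real c) / real n..<(real k - real c + 1) / real n}"
proof -
  have "cell n c s = k \<longleftrightarrow> \<lfloor>real c + real n * s\<rfloor> = int k"
    using assms(2) by (auto simp: cell_def)
  also have "\<dots> \<longleftrightarrow> real k \<le> real c + real n * s \<and> real c + real n * s < real k + 1"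
    unfolding floor_eq_iff by simp
  also have "\<dots> \<longleftrightarrow> s \<in> {(real k - real c) / real n..<(real k - real c + 1) / real n}"
    using assms(1) by (auto simp: field_simps)
  finally show ?thesis .
qed

lemma cell_bounds:
  assumes "n > 0" "cell n c s > 0"
  shows "(real (cell n c s) - real c) / real n \<le> s"
    and "s - 1 / real n < (real (cell n c s) - real c) / real n"
  using cell_eq_iff[OF assms, of c s]
  by (auto simp: diff_divide_distrib add_divide_distrib)

lemma has_bochner_integral_step:
  fixes g :: "nat \<Rightarrow> real"
  assumes "n > 0" "finite K" "0 \<notin> K"
  shows "has_bochner_integral lborel (\<lambda>s. indicator K (cell n c s) * g (cell n c s)) ((\<Sum>k\<in>K. g k) / real n)"
proof -
  let ?I = "\<lambda>k. {(real k - real c) / real n..<(real k - real c + 1) / real n}"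
  have "has_bochner_integral lborel (\<lambda>s. \<Sum>k\<in>K. g k * indicator (?I k) s) (\<Sum>k\<in>K. g k * (1 / real n))"
  proof (intro has_bochner_integral_sum has_bochner_integral_mult_right)
    fix k
    have "measure lborel (?I k) = 1 / real n"
      using assms(1) by (subst measure_lborel_Ico) (auto simp: divide_right_mono add_divide_distrib diff_divide_distrib)
    moreover have "has_bochner_integral lborel (indicator (?I k)) (measure lborel (?I k))"
      by (rule has_bochner_integral_real_indicator) (auto simp: emeasure_lborel_Ico divide_right_mono)
    ultimately show "has_bochner_integral lborel (indicator (?I k)) (1 / real n)" by simp
  qed
  moreover have "(\<Sum>k\<in>K. g k * indicator (?I k) s) = indicator K (cell n c s) * g (cell n c s)" for s
  proof -
    have "(\<Sum>k\<in>K. g k * indicator (?I k) s) = (\<Sum>k\<in>K. if cell n c s = k then g k else 0)"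
    proof (rule sum.cong[OF refl])
      fix k assume "k \<in> K"
      then have "k > 0" using assms(3) by (cases k) auto
      then show "g k * indicator (?I k) s = (if cell n c s = k then g k else 0)"
        unfolding cell_eq_iff[OF assms(1) \<open>k > 0\<close>] by (simp add: indicator_def)
    qed
    also have "\<dots> = indicator K (cell n c s) * g (cell n c s)"
      using assms(2) by (simp add: indicator_def)
    finally show ?thesis .
  qed
  ultimately show ?thesis by (simp add: sum_divide_distrib)
qed

lemma integrable_Gaussian:
  assumes "a > 0"
  shows "integrable lborel (\<lambda>s::real. exp (- a * s\<^sup>2))"
proof -
  define \<sigma> where "\<sigma> = sqrt (1 / (2 * a))"
  have "\<sigma>\<^sup>2 = 1 / (2 * a)" "\<sigma> > 0" using assms by (auto simp: \<sigma>_def)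
  then have "exp (- a * s\<^sup>2) = sqrt (2 * pi * \<sigma>\<^sup>2) * normal_density 0 \<sigma> s" for s
    using assms by (simp add: normal_density_def field_simps)
  then show ?thesis
    using integrable_normal_density[OF \<open>\<sigma> > 0\<close>, of 0] by simp
qed

text \<open>
  A local form of Laplace's method.  Around \<open>c n\<close> the log-weight \<open>F n\<close> has slope about \<open>\<beta> / n\<close> and curvature about
  \<open>- D / n\<^sup>2\<close>, so on the scale \<open>k = c n + n * s\<close> the weights converge pointwise to \<open>exp (\<beta> * s - D * s\<^sup>2 / 2)\<close>.
  The same bounds give a Gaussian majorant over the whole index set, and dominated convergence for
  the step functions gives convergence of the sums.  The test functions may depend on \<open>n\<close>, need only converge
  continuously at almost every point, and may grow linearly; this covers both means and distribution
  functions.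
\<close>

lemma Laplace_sum_limit:
  fixes F :: "nat \<Rightarrow> nat \<Rightarrow> real" and K :: "nat \<Rightarrow> nat set" and c :: "nat \<Rightarrow> nat"
  assumes K: "\<And>n. finite (K n)" "eventually (\<lambda>n. 0 \<notin> K n) sequentially"
    and wide: "\<And>s. eventually (\<lambda>n. cell n (c n) s \<in> K n) sequentially"
    and lim: "b \<longlonglongrightarrow> \<beta>" "L \<longlonglongrightarrow> D" "U \<longlonglongrightarrow> D" and D: "D > 0"
    and upper: "eventually (\<lambda>n. \<forall>k\<in>K n. F n k - F n (c n) \<le>
        (real k - real (c n)) / real n * b n
        - L n * ((real k - real (c n)) / real n * ((real k - real (c n)) / real n - 1 / real n) / 2)) sequentially"
    and lower: "eventually (\<lambda>n. \<forall>k\<in>K n.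
        (real k - real (c n)) / real n * b n
        - U n * ((real k - real (c n)) / real n * ((real k - real (c n)) / real n - 1 / real n) / 2)
        \<le> F n k - F n (c n)) sequentially"
    and \<psi>: "\<psi> \<in> borel_measurable borel"
      "\<And>n x. \<bar>\<psi>' n x\<bar> \<le> C * (1 + \<bar>x\<bar>)"
      "AE s in lborel. \<forall>t. t \<longlonglongrightarrow> s \<longrightarrow> (\<lambda>n. \<psi>' n (t n)) \<longlonglongrightarrow> \<psi> s"
  shows "(\<lambda>n. (\<Sum>k\<in>K n. exp (F n k - F n (c n)) * \<psi>' n ((real k - real (c n)) / real n)) / real n)
    \<longlonglongrightarrow> (\<integral>s. exp (\<beta> * s - D * s\<^sup>2 / 2) * \<psi> s \<partial>lborel)"
proof -
  define T where "T n s = (real (cell n (c n) s) - real (c n)) / real n" for n s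
  define f where "f n s = indicator (K n) (cell n (c n) s) *
      (exp (F n (cell n (c n) s) - F n (c n)) * \<psi>' n (T n s))" for n s
  define A where "A = \<bar>\<beta>\<bar> + 1"
  define A' where "A' = A + D / 4 + 1"
  define w where "w s = (C * exp (A' + D / 4 + 4 * A'\<^sup>2 / D)) * exp (- (D / 16) * s\<^sup>2)" for s :: real
  have C: "C \<ge> 0" using order_trans[OF abs_ge_zero \<psi>(2)[of 0 0]] by simp
  have A: "A \<ge> 1" by (simp add: A_def)
  \<comment> \<open>beyond some \<open>n0\<close> the slope is bounded by \<open>A\<close> and at least half of the limiting curvature is present\<close>
  have "eventually (\<lambda>n. \<bar>b n\<bar> \<le> A) sequentially"
    using order_tendstoD(2)[OF tendsto_rabs[OF lim(1)], of A] by (auto simp: A_def elim: eventually_mono)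
  moreover have "eventually (\<lambda>n. L n \<ge> D / 2) sequentially"
    using order_tendstoD(1)[OF lim(2), of "D / 2"] D by (auto elim: eventually_mono)
  ultimately have "eventually (\<lambda>n. n > 0 \<and> 0 \<notin> K n \<and> \<bar>b n\<bar> \<le> A \<and> L n \<ge> D / 2 \<and>
      (\<forall>k\<in>K n. F n k - F n (c n) \<le>
        (real k - real (c n)) / real n * b n
        - L n * ((real k - real (c n)) / real n * ((real k - real (c n)) / real n - 1 / real n) / 2))) sequentially"
    using K(2) upper eventually_gt_at_top[of 0] by eventually_elim auto
  then obtain n0 where n0: "\<And>n. n \<ge> n0 \<Longrightarrow> n > 0 \<and> 0 \<notin> K n \<and> \<bar>b n\<bar> \<le> A \<and> L n \<ge> D / 2 \<and>
      (\<forall>k\<in>K n. F n k - F n (c n) \<le>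
        (real k - real (c n)) / real n * b n
        - L n * ((real k - real (c n)) / real n * ((real k - real (c n)) / real n - 1 / real n) / 2))"
    by (auto simp: eventually_sequentially)
  have T_bounds: "T n s \<le> s" "s - 1 / real n < T n s"
    if "n \<ge> n0" "cell n (c n) s \<in> K n" for n s
  proof -
    have "n > 0" "cell n (c n) s > 0" using n0[OF that(1)] that(2) by (auto intro: gr0I)
    then show "T n s \<le> s" "s - 1 / real n < T n s" unfolding T_def by (rule cell_bounds)+
  qed
  have int: "has_bochner_integral lborel (f n)
      ((\<Sum>k\<in>K n. exp (F n k - F n (c n)) * \<psi>' n ((real k - real (c n)) / real n)) / real n)"
    if "n \<ge> n0" for n
    unfolding f_def T_def using n0[OF that] by (intro has_bochner_integral_step K) auto
  have bound: "\<bar>f n s\<bar> \<le> w s" if n: "n \<ge> n0" for n s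
  proof (cases "cell n (c n) s \<in> K n")
    case False
    then show ?thesis using C by (simp add: f_def w_def)
  next
    case True
    define t where "t = T n s"
    note tb = T_bounds[OF n True, folded t_def]
    have n1: "1 / real n \<le> 1" "1 / real n \<ge> 0" using n0[OF n] by auto
    have ts: "\<bar>t\<bar> \<le> \<bar>s\<bar> + 1" "\<bar>s - t\<bar> \<le> 1" using tb n1 by auto
    have Lp: "L n \<ge> D / 2" and bA: "\<bar>b n\<bar> \<le> A" using n0[OF n] by auto
    \<comment> \<open>this holds because \<open>t\<close> is a multiple of \<open>1 / n\<close>: no lattice point lies strictly between 0 and \<open>1 / n\<close>\<close>
    have q0: "0 \<le> t * (t - 1 / real n)"
    proof -
      define j where "j = int (cell n (c n) s) - int (c n)"
      have "t = real_of_int j / real n" by (simp add: t_def T_def j_def)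
      then have "t * (t - 1 / real n) = real_of_int (j * (j - 1)) / (real n)\<^sup>2"
        by (simp add: power2_eq_square diff_divide_distrib algebra_simps)
      moreover have "j * (j - 1) \<ge> 0"
        by (cases "j \<ge> 1") (auto intro: mult_nonneg_nonneg mult_nonpos_nonpos)
      then have "real_of_int (j * (j - 1)) \<ge> 0" by (rule of_int_0_le_iff[THEN iffD2])
      ultimately show ?thesis by (metis divide_nonneg_nonneg zero_le_power2)
    qed
    have "F n (cell n (c n) s) - F n (c n) \<le> t * b n - L n * (t * (t - 1 / real n) / 2)"
      using n0[OF n] True unfolding t_def T_def by blast
    also have "\<dots> \<le> \<bar>t\<bar> * A - D / 2 * (t * (t - 1 / real n) / 2)"
    proof (rule diff_mono)
      show "t * b n \<le> \<bar>t\<bar> * A"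
        using mult_left_mono[OF bA, of "\<bar>t\<bar>"] abs_ge_self[of "t * b n"] by (simp add: abs_mult)
      show "D / 2 * (t * (t - 1 / real n) / 2) \<le> L n * (t * (t - 1 / real n) / 2)"
        using Lp q0 by (intro mult_right_mono) auto
    qed
    also have "\<dots> \<le> \<bar>t\<bar> * A - D / 4 * (t\<^sup>2 - \<bar>t\<bar>)"
    proof -
      have "t * (1 / real n) \<le> \<bar>t\<bar> * 1"
        using n1 by (intro mult_mono) auto
      then have "D / 4 * (t\<^sup>2 - \<bar>t\<bar>) \<le> D / 4 * (t * (t - 1 / real n))"
        using D by (intro mult_left_mono) (auto simp: power2_eq_square right_diff_distrib)
      then show ?thesis by simp
    qed
    also have "\<dots> = (A + D / 4) * \<bar>t\<bar> - D / 4 * t\<^sup>2"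
      by (simp add: algebra_simps)
    also have "\<dots> \<le> (A + D / 4) * (\<bar>s\<bar> + 1) - D / 4 * (s\<^sup>2 / 2 - 1)"
    proof (rule diff_mono)
      show "(A + D / 4) * \<bar>t\<bar> \<le> (A + D / 4) * (\<bar>s\<bar> + 1)"
        using ts A D by (intro mult_left_mono) auto
      have "s\<^sup>2 \<le> 2 * t\<^sup>2 + 2 * (s - t)\<^sup>2"
        using zero_le_power2[of "s - 2 * t"] by (simp add: power2_eq_square algebra_simps)
      also have "(s - t)\<^sup>2 \<le> 1" using ts(2) by (simp add: abs_square_le_1)
      finally have "s\<^sup>2 / 2 - 1 \<le> t\<^sup>2" by simp
      then show "D / 4 * (s\<^sup>2 / 2 - 1) \<le> D / 4 * t\<^sup>2"
        using D by (intro mult_left_mono) auto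
    qed
    finally have e: "F n (cell n (c n) s) - F n (c n) \<le> (A + D / 4) * (\<bar>s\<bar> + 1) - D / 4 * (s\<^sup>2 / 2 - 1)" .
    have "\<bar>\<psi>' n t\<bar> \<le> C * (1 + \<bar>t\<bar>)" by (rule \<psi>(2))
    also have "\<dots> \<le> C * exp (\<bar>s\<bar> + 1)"
      using exp_ge_add_one_self[of "\<bar>s\<bar> + 1"] ts C by (intro mult_left_mono) auto
    finally have p: "\<bar>\<psi>' n t\<bar> \<le> C * exp (\<bar>s\<bar> + 1)" .
    have "\<bar>f n s\<bar> = exp (F n (cell n (c n) s) - F n (c n)) * \<bar>\<psi>' n t\<bar>"
      using True by (simp add: f_def t_def abs_mult)
    also have "\<dots> \<le> exp ((A + D / 4) * (\<bar>s\<bar> + 1) - D / 4 * (s\<^sup>2 / 2 - 1)) * (C * exp (\<bar>s\<bar> + 1))"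
      using e p by (intro mult_mono) auto
    also have "\<dots> = C * exp (A' * \<bar>s\<bar> + A' + D / 4 - D / 8 * s\<^sup>2)"
      by (simp add: exp_add[symmetric] A'_def field_simps)
    also have "\<dots> \<le> C * exp (A' + D / 4 + 4 * A'\<^sup>2 / D - D / 16 * s\<^sup>2)"
    proof -
      \<comment> \<open>absorb the linear term into half of the quadratic one\<close>
      have "0 \<le> (D / 4 * \<bar>s\<bar> - 2 * A')\<^sup>2 / D" using D by simp
      also have "\<dots> = D / 16 * s\<^sup>2 - A' * \<bar>s\<bar> + 4 * A'\<^sup>2 / D"
        using D by (simp add: power2_eq_square field_simps)
      finally show ?thesis using C by (intro mult_left_mono) auto
    qed
    also have "\<dots> = w s"
      by (simp add: w_def exp_add[symmetric] algebra_simps)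
    finally show ?thesis .
  qed
  have pointwise: "(\<lambda>n. f n s) \<longlonglongrightarrow> exp (\<beta> * s - D * s\<^sup>2 / 2) * \<psi> s"
    if \<psi>s: "\<forall>t. t \<longlonglongrightarrow> s \<longrightarrow> (\<lambda>n. \<psi>' n (t n)) \<longlonglongrightarrow> \<psi> s" for s
  proof -
    have inv: "(\<lambda>n. 1 / real n) \<longlonglongrightarrow> 0" by (rule lim_1_over_n)
    have inK: "eventually (\<lambda>n. n \<ge> n0 \<and> cell n (c n) s \<in> K n) sequentially"
      using wide[of s] eventually_ge_at_top[of n0] by eventually_elim auto
    have Ts: "(\<lambda>n. T n s) \<longlonglongrightarrow> s"
    proof (rule tendsto_sandwich[OF _ _ _ tendsto_const])
      show "eventually (\<lambda>n. s - 1 / real n \<le> T n s) sequentially"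
        using inK by eventually_elim (use T_bounds in force)
      show "eventually (\<lambda>n. T n s \<le> s) sequentially"
        using inK by eventually_elim (use T_bounds in force)
      show "(\<lambda>n. s - 1 / real n) \<longlonglongrightarrow> s" using tendsto_diff[OF tendsto_const inv, of s] by simp
    qed
    have quad: "(\<lambda>n. T n s * b n - V n * (T n s * (T n s - 1 / real n) / 2)) \<longlonglongrightarrow> \<beta> * s - D * s\<^sup>2 / 2"
      if "V \<longlonglongrightarrow> D" for V
    proof -
      have "(\<lambda>n. T n s * b n - V n * (T n s * (T n s - 1 / real n) / 2)) \<longlonglongrightarrow> s * \<beta> - D * (s * (s - 0) / 2)"
        by (intro tendsto_intros Ts lim that inv) auto
      then show ?thesis by (simp add: power2_eq_square mult.commute)
    qed
    have "(\<lambda>n. F n (cell n (c n) s) - F n (c n)) \<longlonglongrightarrow> \<beta> * s - D * s\<^sup>2 / 2"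
    proof (rule tendsto_sandwich[OF _ _ quad[OF lim(3)] quad[OF lim(2)]])
      show "eventually (\<lambda>n. T n s * b n - U n * (T n s * (T n s - 1 / real n) / 2)
          \<le> F n (cell n (c n) s) - F n (c n)) sequentially"
        using inK lower by eventually_elim (auto simp: T_def)
      show "eventually (\<lambda>n. F n (cell n (c n) s) - F n (c n)
          \<le> T n s * b n - L n * (T n s * (T n s - 1 / real n) / 2)) sequentially"
        using inK upper by eventually_elim (auto simp: T_def)
    qed
    moreover have "(\<lambda>n. \<psi>' n (T n s)) \<longlonglongrightarrow> \<psi> s" using \<psi>s Ts by blast
    ultimately have P: "(\<lambda>n. exp (F n (cell n (c n) s) - F n (c n)) * \<psi>' n (T n s))
        \<longlonglongrightarrow> exp (\<beta> * s - D * s\<^sup>2 / 2) * \<psi> s"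
      by (rule tendsto_mult[OF tendsto_exp])
    show ?thesis
    proof (rule Lim_transform_eventually[OF P])
      show "eventually (\<lambda>n. exp (F n (cell n (c n) s) - F n (c n)) * \<psi>' n (T n s) = f n s) sequentially"
        using inK by eventually_elim (simp add: f_def)
    qed
  qed
  have "(\<lambda>n. integral\<^sup>L lborel (f (n + n0))) \<longlonglongrightarrow> (\<integral>s. exp (\<beta> * s - D * s\<^sup>2 / 2) * \<psi> s \<partial>lborel)"
  proof (rule integral_dominated_convergence[where w = w])
    show "(\<lambda>s. exp (\<beta> * s - D * s\<^sup>2 / 2) * \<psi> s) \<in> borel_measurable lborel"
      using \<psi>(1) by measurable
    show "f (n + n0) \<in> borel_measurable lborel" for n
      by (rule borel_measurable_has_bochner_integral[OF int]) simp
    show "integrable lborel w"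
      unfolding w_def using D by (intro integrable_mult_right integrable_Gaussian) auto
    show "AE s in lborel. (\<lambda>n. f (n + n0) s) \<longlonglongrightarrow> exp (\<beta> * s - D * s\<^sup>2 / 2) * \<psi> s"
      using \<psi>(3) by (rule eventually_mono) (rule LIMSEQ_ignore_initial_segment[OF pointwise])
    show "AE s in lborel. norm (f (n + n0) s) \<le> w s" for n
      by (rule AE_I2) (simp only: real_norm_def, rule bound, simp)
  qed
  then have "(\<lambda>n. integral\<^sup>L lborel (f n)) \<longlonglongrightarrow> (\<integral>s. exp (\<beta> * s - D * s\<^sup>2 / 2) * \<psi> s \<partial>lborel)"
    by (rule LIMSEQ_offset)
  then show ?thesis
  proof (rule Lim_transform_eventually)
    show "eventually (\<lambda>n. integral\<^sup>L lborel (f n) =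
        (\<Sum>k\<in>K n. exp (F n k - F n (c n)) * \<psi>' n ((real k - real (c n)) / real n)) / real n) sequentially"
      using eventually_ge_at_top[of n0]
      by eventually_elim (rule has_bochner_integral_integral_eq[OF int])
  qed
qed

lemma exp_quadratic_normal_density:
  assumes "D > 0"
  shows "exp (\<beta> * s - D * s\<^sup>2 / 2) =
    exp (\<beta>\<^sup>2 / (2 * D)) * sqrt (2 * pi / D) * normal_density (\<beta> / D) (1 / sqrt D) s"
proof -
  have "- (s - \<beta> / D)\<^sup>2 / (2 * (1 / sqrt D)\<^sup>2) = (\<beta> * s - D * s\<^sup>2 / 2) - \<beta>\<^sup>2 / (2 * D)"
    using assms by (simp add: power2_eq_square field_simps)
  then show ?thesis
    using assms by (simp add: normal_density_def exp_diff power_divide real_sqrt_divide)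
qed

section \<open>Differences of the log-weight\<close>

lemma weight_ratio:
  assumes "k < n choose 2"
  shows "ln (weight n \<alpha> h (Suc k)) - ln (weight n \<alpha> h k) =
    ln (real (n choose 2) - real k) - ln (real k + 1)
    + 4 * \<alpha> / (3 * real n ^ 4) * (3 * real k ^ 2 + 3 * real k + 1) + h"
proof -
  let ?N = "n choose 2"
  have "Suc k * (?N choose Suc k) = (?N - k) * (?N choose k)"
    using binomial_absorption[of k ?N] binomial_absorb_comp[of ?N k] by simp
  then have "real (Suc k) * real (?N choose Suc k) = (real ?N - real k) * real (?N choose k)"
    using assms by (metis of_nat_mult of_nat_diff less_imp_le)
  then have "ln (real (Suc k) * real (?N choose Suc k)) = ln ((real ?N - real k) * real (?N choose k))"
    by simp
  then have "ln (real (Suc k)) + ln (real (?N choose Suc k)) = ln (real ?N - real k) + ln (real (?N choose k))"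
    using assms by (simp add: ln_mult)
  moreover have "(real k + 1) ^ 3 = real k ^ 3 + (3 * real k ^ 2 + 3 * real k + 1)"
    by (simp add: power2_eq_square power3_eq_cube algebra_simps)
  moreover define a where "a = 4 * \<alpha> / (3 * real n ^ 4)"
  ultimately show ?thesis
    using assms unfolding weight_def a_def[symmetric]
    by (simp add: ln_mult distrib_left distrib_right add.commute)
qed

lemma ln_diff_bounds:
  fixes x :: real
  assumes "x > 0"
  shows "1 / (x + 1) \<le> ln (x + 1) - ln x" "ln (x + 1) - ln x \<le> 1 / x"
proof -
  have "ln x - ln (x + 1) = ln (x / (x + 1))" using assms by (simp add: ln_div)
  also have "\<dots> \<le> x / (x + 1) - 1" using assms by (intro ln_le_minus_one) simp
  finally show "1 / (x + 1) \<le> ln (x + 1) - ln x" using assms by (simp add: field_simps)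
  have "ln (x + 1) - ln x = ln ((x + 1) / x)" using assms by (simp add: ln_div)
  also have "\<dots> \<le> (x + 1) / x - 1" using assms by (intro ln_le_minus_one) simp
  finally show "ln (x + 1) - ln x \<le> 1 / x" using assms by (simp add: field_simps)
qed

lemma real_choose_2: "real (n choose 2) = real n ^ 2 / 2 * (1 - 1 / real n)"
proof (cases "n = 0")
  case False
  have "even (n * (n - 1))" by (cases "even n") auto
  then have "real (n choose 2) = real n * (real n - 1) / 2"
    using False by (simp add: choose_two real_of_nat_div of_nat_diff)
  moreover have "real n ^ 2 / 2 * (1 - 1 / real n) = real n * (real n - 1) / 2"
    using False by (simp add: power2_eq_square right_diff_distrib)
  ultimately show ?thesis by simp
qed simp

text \<open>
  With \<open>k \<approx> n\<^sup>2 * u / 2\<close> the binomial coefficient contributes about \<open>- (2 / u + 2 / (1 - u)) / n\<^sup>2\<close> to the second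
  difference of the log-weight and the cubic term \<open>4 * \<alpha> * u / n\<^sup>2\<close>.  Working with second differences avoids
  Stirling's formula, and the bounds are uniform over the window of half-width \<open>\<eta>\<close>.
\<close>

lemma second_difference_bounds:
  fixes \<eta> h :: real
  assumes n: "n > 0" and \<alpha>: "\<alpha> > 0"
    and \<eta>: "u - \<eta> > 0" "1 - 1 / real n - u - \<eta> > 0"
    and k: "u - \<eta> \<le> 2 * real k / real n ^ 2" "2 * real (Suc (Suc k)) / real n ^ 2 \<le> u + \<eta>"
  defines "F \<equiv> \<lambda>k. ln (weight n \<alpha> h k)"
  shows "F (Suc (Suc k)) - 2 * F (Suc k) + F k
      \<le> - (2 / (u + \<eta>) + 2 / (1 - u + \<eta>) - 4 * \<alpha> * (u + \<eta>)) / real n ^ 2"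
    and "- (2 / (u - \<eta>) + 2 / (1 - 1 / real n - u - \<eta>) - 4 * \<alpha> * (u - \<eta>)) / real n ^ 2
      \<le> F (Suc (Suc k)) - 2 * F (Suc k) + F k"
proof -
  let ?N = "real (n choose 2)" and ?n2 = "real n ^ 2"
  have n2: "?n2 > 0" using n by simp
  have k1: "?n2 * (u - \<eta>) / 2 \<le> real k" using k(1) n2 by (simp add: field_simps)
  have k2: "real k + 2 \<le> ?n2 * (u + \<eta>) / 2" using k(2) n2 by (simp add: field_simps)
  have kpos: "real k > 0" using k1 \<eta>(1) n2 by (smt (verit) mult_pos_pos half_gt_zero)
  have N1: "?n2 * (1 - 1 / real n - u - \<eta>) / 2 \<le> ?N - real k - 1"
    using k2 by (simp add: real_choose_2 algebra_simps diff_divide_distrib)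
  have N2: "?N - real k \<le> ?n2 * (1 - u + \<eta>) / 2"
  proof -
    have "?N \<le> ?n2 / 2"
      unfolding real_choose_2 by (simp add: mult_le_cancel_left1 mult_left_le)
    moreover have "?n2 * (1 - u + \<eta>) / 2 = ?n2 / 2 - ?n2 * (u - \<eta>) / 2"
      by (simp add: field_simps)
    ultimately show ?thesis using k1 by linarith
  qed
  have N1pos: "?N - real k - 1 > 0" using N1 \<eta>(2) n2 by (smt (verit) mult_pos_pos half_gt_zero)
  then have lt: "Suc k < n choose 2" by linarith
  define d where "d = (ln (?N - real k) - ln (?N - real k - 1)) + (ln (real k + 2) - ln (real k + 1))
      - 8 * \<alpha> * (real k + 1) / real n ^ 4"
  have eq: "F (Suc (Suc k)) - 2 * F (Suc k) + F k = - d"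
  proof -
    have 1: "F (Suc (Suc k)) - F (Suc k) = ln (?N - real k - 1) - ln (real k + 2)
      + 4 * \<alpha> / (3 * real n ^ 4) * (3 * (real k + 1) ^ 2 + 3 * (real k + 1) + 1) + h"
      unfolding F_def using weight_ratio[OF lt, of \<alpha> h] by (simp add: algebra_simps)
    have 2: "F (Suc k) - F k = ln (?N - real k) - ln (real k + 1)
      + 4 * \<alpha> / (3 * real n ^ 4) * (3 * real k ^ 2 + 3 * real k + 1) + h"
      unfolding F_def using weight_ratio[of k n \<alpha> h] lt by simp
    have 3: "4 * \<alpha> / (3 * real n ^ 4) * (3 * (real k + 1) ^ 2 + 3 * (real k + 1) + 1)
        - 4 * \<alpha> / (3 * real n ^ 4) * (3 * real k ^ 2 + 3 * real k + 1) = 8 * \<alpha> * (real k + 1) / real n ^ 4"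
      using n by (simp add: field_simps power2_eq_square)
    show ?thesis using 1 2 3 unfolding d_def by linarith
  qed
  have lnN: "1 / (?N - real k) \<le> ln (?N - real k) - ln (?N - real k - 1)"
     "ln (?N - real k) - ln (?N - real k - 1) \<le> 1 / (?N - real k - 1)"
    using ln_diff_bounds[OF N1pos] by simp_all
  have lnk: "1 / (real k + 2) \<le> ln (real k + 2) - ln (real k + 1)"
     "ln (real k + 2) - ln (real k + 1) \<le> 1 / (real k + 1)"
    using ln_diff_bounds[of "real k + 1"] by (simp_all add: add.assoc)
  have inv: "1 / (?n2 * x / 2) = 2 / x / ?n2" if "x > 0" for x
    using that n2 by (simp add: field_simps)
  have n4: "real n ^ 4 = ?n2 * ?n2" by (simp add: power2_eq_square power4_eq_xxxx)
  have cub: "4 * \<alpha> * x / ?n2 = 8 * \<alpha> * (?n2 * x / 2) / real n ^ 4" for x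
    using n2 unfolding n4 by (simp add: field_simps)
  have mono: "8 * \<alpha> * x / real n ^ 4 \<le> 8 * \<alpha> * y / real n ^ 4" if "x \<le> y" for x y
    using that \<alpha> by (intro divide_right_mono mult_left_mono) auto
  have up: "u + \<eta> > 0" "1 - u + \<eta> > 0"
  proof -
    have "0 < ?n2 * (u + \<eta>)" using k2 kpos by linarith
    then show "u + \<eta> > 0" using n2 by (simp add: zero_less_mult_iff)
    have "0 < ?n2 * (1 - u + \<eta>)" using N2 N1pos by linarith
    then show "1 - u + \<eta> > 0" using n2 by (simp add: zero_less_mult_iff)
  qed
  have "2 / (u + \<eta>) / ?n2 \<le> 1 / (real k + 2)"
    unfolding inv[OF up(1), symmetric] using k2 kpos by (intro divide_left_mono) auto
  moreover have "2 / (1 - u + \<eta>) / ?n2 \<le> 1 / (?N - real k)"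
    unfolding inv[OF up(2), symmetric] using N2 N1pos by (intro divide_left_mono) auto
  moreover have "8 * \<alpha> * (real k + 1) / real n ^ 4 \<le> 4 * \<alpha> * (u + \<eta>) / ?n2"
    unfolding cub using k2 by (intro mono) auto
  ultimately have "(2 / (u + \<eta>) + 2 / (1 - u + \<eta>) - 4 * \<alpha> * (u + \<eta>)) / ?n2 \<le> d"
    using lnN(1) lnk(1) unfolding d_def add_divide_distrib diff_divide_distrib by linarith
  then show "F (Suc (Suc k)) - 2 * F (Suc k) + F k
      \<le> - (2 / (u + \<eta>) + 2 / (1 - u + \<eta>) - 4 * \<alpha> * (u + \<eta>)) / ?n2"
    unfolding eq minus_divide_left[symmetric] by simp
  have "1 / (real k + 1) \<le> 2 / (u - \<eta>) / ?n2"
    unfolding inv[OF \<eta>(1), symmetric] using k1 \<eta>(1) n2 by (intro divide_left_mono) auto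
  moreover have "1 / (?N - real k - 1) \<le> 2 / (1 - 1 / real n - u - \<eta>) / ?n2"
    unfolding inv[OF \<eta>(2), symmetric] using N1 N1pos \<eta>(2) n2
    by (intro divide_left_mono mult_pos_pos) auto
  moreover have "4 * \<alpha> * (u - \<eta>) / ?n2 \<le> 8 * \<alpha> * (real k + 1) / real n ^ 4"
    unfolding cub using k1 by (intro mono) auto
  ultimately have "d \<le> (2 / (u - \<eta>) + 2 / (1 - 1 / real n - u - \<eta>) - 4 * \<alpha> * (u - \<eta>)) / ?n2"
    using lnN(2) lnk(2) unfolding d_def add_divide_distrib diff_divide_distrib by linarith
  then show "- (2 / (u - \<eta>) + 2 / (1 - 1 / real n - u - \<eta>) - 4 * \<alpha> * (u - \<eta>)) / ?n2
      \<le> F (Suc (Suc k)) - 2 * F (Suc k) + F k"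
    unfolding eq minus_divide_left[symmetric] by simp
qed

text \<open>
  The delta method for deterministic sequences.
\<close>

lemma rate_preserved_by_derivative:
  fixes f :: "real \<Rightarrow> real"
  assumes "(f has_real_derivative f') (at x0)" and lim: "(\<lambda>n. real n * (x n - x0)) \<longlonglongrightarrow> a"
  shows "(\<lambda>n. real n * (f (x n) - f x0)) \<longlonglongrightarrow> f' * a"
proof -
  have "(\<lambda>n. 1 / real n * (real n * (x n - x0))) \<longlonglongrightarrow> 0 * a"
    by (intro tendsto_mult lim lim_1_over_n)
  then have "(\<lambda>n. x n - x0) \<longlonglongrightarrow> 0 * a"
  proof (rule Lim_transform_eventually)
    show "eventually (\<lambda>n. 1 / real n * (real n * (x n - x0)) = x n - x0) sequentially"
      using eventually_gt_at_top[of 0] by eventually_elim simp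
  qed
  then have "(\<lambda>n. x n - x0) \<longlonglongrightarrow> 0" by simp
  then have x: "x \<longlonglongrightarrow> x0" using LIM_zero_iff by blast
  obtain g where g: "\<And>z. f z - f x0 = g z * (z - x0)" "isCont g x0" "g x0 = f'"
    using assms(1) by (auto simp: CARAT_DERIV)
  have "(\<lambda>n. g (x n) * (real n * (x n - x0))) \<longlonglongrightarrow> g x0 * a"
    by (intro tendsto_mult lim isCont_tendsto_compose[OF g(2)] x)
  then show ?thesis by (simp add: g algebra_simps)
qed

definition center :: "nat \<Rightarrow> real \<Rightarrow> nat" where
  "center n u = nat \<lfloor>real n ^ 2 * u / 2\<rfloor>"

lemma center_bounds:
  assumes "u \<ge> 0"
  shows "real n ^ 2 * u / 2 - 1 \<le> real (center n u)" "real (center n u) \<le> real n ^ 2 * u / 2"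
proof -
  have "real (center n u) = of_int \<lfloor>real n ^ 2 * u / 2\<rfloor>"
    using assms by (simp add: center_def)
  then show "real n ^ 2 * u / 2 - 1 \<le> real (center n u)" "real (center n u) \<le> real n ^ 2 * u / 2"
    using floor_correct[of "real n ^ 2 * u / 2"] by linarith+
qed

text \<open>
  A displacement of order \<open>n\<close> in the number of edges changes the edge density by order \<open>1 / n\<close>, which is much less
  than the width \<open>n powr - \<delta>\<close> of the window because \<open>\<delta> < 1\<close>.
\<close>

lemma eventually_in_window:
  assumes \<delta>: "0 < \<delta>" "\<delta> < 1" and u: "0 < u" "u < 1"
  shows "eventually (\<lambda>n. \<forall>k. \<bar>real k - real n ^ 2 * u / 2\<bar> \<le> R * real n \<longrightarrow> k \<in> window n \<delta> u) sequentially"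
proof -
  have "(\<lambda>n. real n powr - \<delta>) \<longlonglongrightarrow> 0" "(\<lambda>n. real n powr (\<delta> - 1)) \<longlonglongrightarrow> 0"
    using \<delta> by (auto intro!: tendsto_neg_powr filterlim_real_sequentially)
  from tendsto_add[OF this(1) lim_1_over_n] tendsto_mult[OF tendsto_const this(2), of "2 * R"]
  have "(\<lambda>n. real n powr - \<delta> + 1 / real n) \<longlonglongrightarrow> 0" "(\<lambda>n. 2 * R * real n powr (\<delta> - 1)) \<longlonglongrightarrow> 0"
    by simp_all
  then have "eventually (\<lambda>n. real n powr - \<delta> + 1 / real n < 1 - u) sequentially"
      "eventually (\<lambda>n. 2 * R * real n powr (\<delta> - 1) < 1) sequentially"
    using u by (auto intro: order_tendstoD)
  then show ?thesis
    using eventually_gt_at_top[of 0]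
  proof eventually_elim
    case (elim n)
    have n: "real n > 0" using elim by simp
    show ?case
    proof (intro allI impI)
      fix k assume k: "\<bar>real k - real n ^ 2 * u / 2\<bar> \<le> R * real n"
      have "2 * real k / real n ^ 2 - u = 2 / real n ^ 2 * (real k - real n ^ 2 * u / 2)"
        using n by (simp add: field_simps)
      then have "\<bar>2 * real k / real n ^ 2 - u\<bar> = 2 / real n ^ 2 * \<bar>real k - real n ^ 2 * u / 2\<bar>"
        by (simp only: abs_mult) simp
      also have "\<dots> \<le> 2 / real n ^ 2 * (R * real n)"
        using k by (intro mult_left_mono) auto
      also have "\<dots> = 2 * R * real n powr (\<delta> - 1) * real n powr - \<delta>"
      proof -
        have "real n powr (\<delta> - 1) * real n powr - \<delta> = real n powr (- 1)"
          using powr_add[of "real n" "\<delta> - 1" "- \<delta>"] by simp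
        also have "\<dots> = 1 / real n" using n by (rule powr_neg_one)
        finally have "real n powr (\<delta> - 1) * real n powr - \<delta> = 1 / real n" .
        then show ?thesis by (simp only: mult.assoc) (simp add: power2_eq_square)
      qed
      also have "\<dots> \<le> 1 * real n powr - \<delta>"
        using elim by (intro mult_right_mono) auto
      finally have w: "\<bar>2 * real k / real n ^ 2 - u\<bar> \<le> real n powr - \<delta>" by simp
      then have "2 * real k / real n ^ 2 \<le> 1 - 1 / real n" using elim by linarith
      then have "real k \<le> real n ^ 2 * (1 - 1 / real n) / 2" using n by (simp add: field_simps)
      then have "k \<le> n choose 2" using real_choose_2[of n] by simp
      with w show "k \<in> window n \<delta> u" by (simp add: window_def)
    qed
  qed
qed

text \<open>
  The number of edges of the complete graph is \<open>n\<^sup>2 / 2 - n / 2\<close>, not \<open>n\<^sup>2 / 2\<close>.  The missing \<open>n / 2\<close> edges perturb the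
  critical point equation by a term of order \<open>1 / n\<close>, and so shift the center of the conditional law by order \<open>n\<close>, the
  order of its fluctuations.  This is why the limit theorem is centered at the mean and not at
  \<open>n\<^sup>2 * u / 2\<close>.
\<close>

lemma center_slope_limit:
  assumes u: "0 < u" "u < 1" and crit: "ln u - ln (1 - u) - \<alpha> * u\<^sup>2 = h"
  shows "(\<lambda>n. real n * (ln (weight n \<alpha> h (Suc (center n u))) - ln (weight n \<alpha> h (center n u))))
    \<longlonglongrightarrow> - 1 / (1 - u)"
proof -
  define m where "m n = 2 * real (center n u) / real n ^ 2" for n
  define A where "A n = 1 - 1 / real n - m n" for n
  define B where "B n = m n + 2 / real n ^ 2" for n
  have inv: "(\<lambda>n. 1 / real n) \<longlonglongrightarrow> 0" by (rule lim_1_over_n)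
  have m: "(\<lambda>n. real n * (m n - u)) \<longlonglongrightarrow> 0"
  proof (rule tendsto_sandwich[of "\<lambda>n. - 2 * (1 / real n)" _ _ "\<lambda>n. 0"])
    have m_eq: "real n * (m n - u) = 2 * (real (center n u) - real n ^ 2 * u / 2) / real n" if "n > 0" for n
      using that by (simp add: m_def power2_eq_square field_simps)
    have "- 2 * (1 / real n) \<le> real n * (m n - u) \<and> real n * (m n - u) \<le> 0" if "n > 0" for n
    proof -
      have "- 2 / real n \<le> 2 * (real (center n u) - real n ^ 2 * u / 2) / real n"
        using center_bounds(1)[of u n] u by (intro divide_right_mono) auto
      moreover have "2 * (real (center n u) - real n ^ 2 * u / 2) / real n \<le> 0 / real n"
        using center_bounds(2)[of u n] u by (intro divide_right_mono) auto
      ultimately show ?thesis unfolding m_eq[OF that] by simp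
    qed
    then show "eventually (\<lambda>n. - 2 * (1 / real n) \<le> real n * (m n - u)) sequentially"
      "eventually (\<lambda>n. real n * (m n - u) \<le> 0) sequentially"
      by (auto intro: eventually_mono[OF eventually_gt_at_top[of 0]])
  qed (use tendsto_mult_right_zero[OF inv, of "-2"] in auto)
  have A: "(\<lambda>n. real n * (A n - (1 - u))) \<longlonglongrightarrow> - 1"
  proof -
    have "(\<lambda>n. - 1 - real n * (m n - u)) \<longlonglongrightarrow> - 1 - 0" by (intro tendsto_intros m)
    then have "(\<lambda>n. - 1 - real n * (m n - u)) \<longlonglongrightarrow> - 1" by simp
    then show ?thesis
    proof (rule Lim_transform_eventually)
      show "eventually (\<lambda>n. - 1 - real n * (m n - u) = real n * (A n - (1 - u))) sequentially"
        using eventually_gt_at_top[of 0] by eventually_elim (simp add: A_def field_simps)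
    qed
  qed
  have B: "(\<lambda>n. real n * (B n - u)) \<longlonglongrightarrow> 0"
  proof -
    have "(\<lambda>n. real n * (m n - u) + 2 * (1 / real n)) \<longlonglongrightarrow> 0 + 2 * 0" by (intro tendsto_intros m inv)
    then have "(\<lambda>n. real n * (m n - u) + 2 * (1 / real n)) \<longlonglongrightarrow> 0" by simp
    then show ?thesis
    proof (rule Lim_transform_eventually)
      show "eventually (\<lambda>n. real n * (m n - u) + 2 * (1 / real n) = real n * (B n - u)) sequentially"
        using eventually_gt_at_top[of 0]
        by eventually_elim (simp add: B_def power2_eq_square field_simps)
    qed
  qed
  have mu: "m \<longlonglongrightarrow> u"
  proof -
    have "(\<lambda>n. 1 / real n * (real n * (m n - u)) + u) \<longlonglongrightarrow> 0 * 0 + u" by (intro tendsto_intros inv m)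
    then have "(\<lambda>n. 1 / real n * (real n * (m n - u)) + u) \<longlonglongrightarrow> u" by simp
    then show ?thesis
    proof (rule Lim_transform_eventually)
      show "eventually (\<lambda>n. 1 / real n * (real n * (m n - u)) + u = m n) sequentially"
        using eventually_gt_at_top[of 0] by eventually_elim simp
    qed
  qed
  have lnA: "(\<lambda>n. real n * (ln (A n) - ln (1 - u))) \<longlonglongrightarrow> inverse (1 - u) * - 1"
    by (rule rate_preserved_by_derivative[OF DERIV_ln A]) (use u in simp)
  have lnB: "(\<lambda>n. real n * (ln (B n) - ln u)) \<longlonglongrightarrow> inverse u * 0"
    by (rule rate_preserved_by_derivative[OF DERIV_ln B]) (use u in simp)
  have sq: "(\<lambda>n. real n * ((m n)\<^sup>2 - u\<^sup>2)) \<longlonglongrightarrow> (2 * u) * 0"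
    by (rule rate_preserved_by_derivative[where f = "\<lambda>x. x\<^sup>2", OF _ m]) (auto intro!: derivative_eq_intros)
  have rest: "(\<lambda>n. \<alpha> * (2 * m n * (1 / real n) + 4 / 3 * ((1 / real n) * (1 / real n) * (1 / real n))))
      \<longlonglongrightarrow> \<alpha> * (2 * u * 0 + 4 / 3 * (0 * 0 * 0))"
    by (intro tendsto_intros mu inv)
  have "(\<lambda>n. real n * (ln (A n) - ln (1 - u)) - real n * (ln (B n) - ln u)
      + \<alpha> * (real n * ((m n)\<^sup>2 - u\<^sup>2))
      + \<alpha> * (2 * m n * (1 / real n) + 4 / 3 * ((1 / real n) * (1 / real n) * (1 / real n))))
      \<longlonglongrightarrow> inverse (1 - u) * - 1 - inverse u * 0 + \<alpha> * ((2 * u) * 0) + \<alpha> * (2 * u * 0 + 4 / 3 * (0 * 0 * 0))"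
    by (rule tendsto_add[OF tendsto_add[OF tendsto_diff[OF lnA lnB] tendsto_mult[OF tendsto_const sq]] rest])
  then have lim: "(\<lambda>n. real n * (ln (A n) - ln (1 - u)) - real n * (ln (B n) - ln u)
      + \<alpha> * (real n * ((m n)\<^sup>2 - u\<^sup>2))
      + \<alpha> * (2 * m n * (1 / real n) + 4 / 3 * ((1 / real n) * (1 / real n) * (1 / real n))))
      \<longlonglongrightarrow> - 1 / (1 - u)"
    by (simp add: inverse_eq_divide)
  show ?thesis
  proof (rule Lim_transform_eventually[OF lim])
    have "A \<longlonglongrightarrow> 1 - 0 - u" unfolding A_def by (intro tendsto_intros inv mu)
    then have "eventually (\<lambda>n. A n > 0) sequentially" using order_tendstoD(1)[of A "1 - u" sequentially 0] u by simp
    then show "eventually (\<lambda>n. real n * (ln (A n) - ln (1 - u)) - real n * (ln (B n) - ln u)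
      + \<alpha> * (real n * ((m n)\<^sup>2 - u\<^sup>2))
      + \<alpha> * (2 * m n * (1 / real n) + 4 / 3 * ((1 / real n) * (1 / real n) * (1 / real n)))
      = real n * (ln (weight n \<alpha> h (Suc (center n u))) - ln (weight n \<alpha> h (center n u)))) sequentially"
      using eventually_gt_at_top[of 0]
    proof eventually_elim
      case (elim n)
      let ?k = "real (center n u)" and ?N = "real (n choose 2)"
      have n: "real n > 0" using elim by simp
      have N: "?N - ?k = real n ^ 2 / 2 * A n"
        using n by (simp add: real_choose_2 A_def m_def right_diff_distrib)
      have "?N - ?k > 0" unfolding N using elim n by simp
      then have lt: "center n u < n choose 2" by simp
      have k: "?k + 1 = real n ^ 2 / 2 * B n"
        using n by (simp add: B_def m_def distrib_left)
      have Bpos: "B n > 0" using n by (simp add: B_def m_def add_nonneg_pos)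
      have "ln (real n ^ 2 / 2 * y) = ln (real n ^ 2 / 2) + ln y" if "y > 0" for y :: real
        using n that by (intro ln_mult_pos) auto
      from this[OF elim(1)] this[OF Bpos] have "ln (?N - ?k) - ln (?k + 1) = ln (A n) - ln (B n)"
        unfolding N k by linarith
      moreover have "4 * \<alpha> / (3 * real n ^ 4) * (3 * ?k ^ 2 + 3 * ?k + 1)
          = \<alpha> * ((m n)\<^sup>2 + 2 * m n / real n ^ 2 + 4 / (3 * real n ^ 4))"
        using n by (simp add: m_def field_simps power2_eq_square power4_eq_xxxx)
      ultimately have "ln (weight n \<alpha> h (Suc (center n u))) - ln (weight n \<alpha> h (center n u)) =
          ln (A n) - ln (B n) + \<alpha> * ((m n)\<^sup>2 + 2 * m n / real n ^ 2 + 4 / (3 * real n ^ 4)) + h"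
        using weight_ratio[OF lt, of \<alpha> h] by simp
      also have "\<dots> = (ln (A n) - ln (1 - u)) - (ln (B n) - ln u) + \<alpha> * ((m n)\<^sup>2 - u\<^sup>2)
          + \<alpha> * (2 * m n / real n ^ 2 + 4 / (3 * real n ^ 4))"
        unfolding crit[symmetric] by (simp add: algebra_simps)
      finally have slope: "ln (weight n \<alpha> h (Suc (center n u))) - ln (weight n \<alpha> h (center n u)) =
          (ln (A n) - ln (1 - u)) - (ln (B n) - ln u) + \<alpha> * ((m n)\<^sup>2 - u\<^sup>2)
          + \<alpha> * (2 * m n / real n ^ 2 + 4 / (3 * real n ^ 4))" .
      have "real n * (2 * m n / real n ^ 2 + 4 / (3 * real n ^ 4)) =
          2 * m n * (1 / real n) + 4 / 3 * ((1 / real n) * (1 / real n) * (1 / real n))"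
        using n by (simp add: power2_eq_square power4_eq_xxxx distrib_left)
      moreover have "c * (X - Y + \<alpha> * Z + \<alpha> * W) = c * X - c * Y + \<alpha> * (c * Z) + \<alpha> * (c * W)"
        for c X Y Z W :: real
        by (simp add: algebra_simps)
      ultimately show ?case unfolding slope by (simp only:)
    qed
  qed
qed

section \<open>Averages over the window\<close>

text \<open>
  The Taylor bounds in the scaled variable \<open>t\<close>.
\<close>

lemma window_log_weight_bounds:
  fixes u \<alpha> h \<delta> :: real
  assumes n: "n > 0" and \<alpha>: "\<alpha> > 0"
  defines "\<eta> \<equiv> real n powr - \<delta>" and "F \<equiv> \<lambda>k. ln (weight n \<alpha> h k)" and "c \<equiv> center n u"
  assumes \<eta>: "u - \<eta> > 0" "1 - 1 / real n - u - \<eta> > 0"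
    and c: "c \<in> window n \<delta> u" "Suc c \<in> window n \<delta> u"
    and k: "k \<in> window n \<delta> u"
  defines "t \<equiv> (real k - real c) / real n"
  shows "F k - F c \<le> t * (real n * (F (Suc c) - F c))
      - (2 / (u + \<eta>) + 2 / (1 - u + \<eta>) - 4 * \<alpha> * (u + \<eta>)) * (t * (t - 1 / real n) / 2)"
    and "t * (real n * (F (Suc c) - F c))
      - (2 / (u - \<eta>) + 2 / (1 - 1 / real n - u - \<eta>) - 4 * \<alpha> * (u - \<eta>)) * (t * (t - 1 / real n) / 2)
      \<le> F k - F c"
proof -
  have tj: "real k - real c = real n * t" using n by (simp add: t_def)
  have quad: "a / real n ^ 2 * ((real k - real c) * (real k - real c - 1) / 2) = a * (t * (t - 1 / real n) / 2)" for a
    unfolding tj using n by (simp add: power2_eq_square field_simps)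
  have lin: "(real k - real c) * (F (Suc c) - F c) = t * (real n * (F (Suc c) - F c))"
    unfolding tj by simp
  \<comment> \<open>the window is an interval, so it contains everything between \<open>k\<close> and the base points \<open>c\<close>, \<open>Suc c\<close>\<close>
  let ?lo = "min k c" and ?hi = "max k (Suc c)"
  have range: "u - \<eta> \<le> 2 * real l / real n ^ 2" "2 * real (Suc (Suc l)) / real n ^ 2 \<le> u + \<eta>"
    if l: "?lo \<le> l" "Suc (Suc l) \<le> ?hi" for l
  proof -
    have "?lo \<in> window n \<delta> u" "?hi \<in> window n \<delta> u" using c k by (auto simp: min_def max_def)
    then have "u - \<eta> \<le> 2 * real ?lo / real n ^ 2" "2 * real ?hi / real n ^ 2 \<le> u + \<eta>"
      by (auto simp: window_def \<eta>_def abs_le_iff)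
    moreover have "2 * real ?lo / real n ^ 2 \<le> 2 * real l / real n ^ 2"
      "2 * real (Suc (Suc l)) / real n ^ 2 \<le> 2 * real ?hi / real n ^ 2"
      using l by (auto intro!: divide_right_mono simp del: of_nat_Suc of_nat_min of_nat_max)
    ultimately show "u - \<eta> \<le> 2 * real l / real n ^ 2" "2 * real (Suc (Suc l)) / real n ^ 2 \<le> u + \<eta>"
      by linarith+
  qed
  have "F k \<le> F c + (real k - real c) * (F (Suc c) - F c)
      - (2 / (u + \<eta>) + 2 / (1 - u + \<eta>) - 4 * \<alpha> * (u + \<eta>)) / real n ^ 2 *
        ((real k - real c) * (real k - real c - 1) / 2)"
  proof (rule discrete_Taylor_upper[where lo = ?lo and hi = ?hi])
    fix l assume "?lo \<le> l" "Suc (Suc l) \<le> ?hi"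
    from second_difference_bounds(1)[OF n \<alpha> \<eta> range[OF this], of h]
    show "F (Suc (Suc l)) - 2 * F (Suc l) + F l
        \<le> - ((2 / (u + \<eta>) + 2 / (1 - u + \<eta>) - 4 * \<alpha> * (u + \<eta>)) / real n ^ 2)"
      by (simp only: F_def minus_divide_left)
  qed auto
  then show "F k - F c \<le> t * (real n * (F (Suc c) - F c))
      - (2 / (u + \<eta>) + 2 / (1 - u + \<eta>) - 4 * \<alpha> * (u + \<eta>)) * (t * (t - 1 / real n) / 2)"
    unfolding quad lin by linarith
  have "F c + (real k - real c) * (F (Suc c) - F c)
      - (2 / (u - \<eta>) + 2 / (1 - 1 / real n - u - \<eta>) - 4 * \<alpha> * (u - \<eta>)) / real n ^ 2 *
        ((real k - real c) * (real k - real c - 1) / 2) \<le> F k"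
  proof (rule discrete_Taylor_lower[where lo = ?lo and hi = ?hi])
    fix l assume "?lo \<le> l" "Suc (Suc l) \<le> ?hi"
    from second_difference_bounds(2)[OF n \<alpha> \<eta> range[OF this], of h]
    show "- ((2 / (u - \<eta>) + 2 / (1 - 1 / real n - u - \<eta>) - 4 * \<alpha> * (u - \<eta>)) / real n ^ 2)
        \<le> F (Suc (Suc l)) - 2 * F (Suc l) + F l"
      by (simp only: F_def minus_divide_left)
  qed auto
  then show "t * (real n * (F (Suc c) - F c))
      - (2 / (u - \<eta>) + 2 / (1 - 1 / real n - u - \<eta>) - 4 * \<alpha> * (u - \<eta>)) * (t * (t - 1 / real n) / 2)
      \<le> F k - F c"
    unfolding quad lin by linarith
qed

lemma eventually_cell_in_window:
  assumes \<delta>: "0 < \<delta>" "\<delta> < 1" and u: "0 < u" "u < 1"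
  shows "eventually (\<lambda>n. cell n (center n u) s \<in> window n \<delta> u) sequentially"
proof -
  have "eventually (\<lambda>n. real n \<ge> 2 * (\<bar>s\<bar> + 1) / u) sequentially"
    by (rule eventually_ge_at_top[THEN eventually_compose_filterlim, OF filterlim_real_sequentially])
  with eventually_in_window[OF \<delta> u, of "\<bar>s\<bar> + 2"] eventually_gt_at_top[of 0] show ?thesis
  proof eventually_elim
    case (elim n)
    let ?c = "real (center n u)"
    have n: "real n \<ge> 1" using elim by simp
    note cb = center_bounds[of u n]
    have s: "\<bar>real n * s\<bar> \<le> real n * \<bar>s\<bar>" by (simp add: abs_mult)
    have "real n * (\<bar>s\<bar> + 1) \<le> real n * (real n * u / 2)"
      using elim(3) u n by (intro mult_left_mono) (auto simp: field_simps)
    also have "\<dots> = real n ^ 2 * u / 2" by (simp add: power2_eq_square)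
    finally have "0 \<le> ?c + real n * s"
      using cb(1) u n s by (simp add: distrib_left)
    then have "0 \<le> \<lfloor>?c + real n * s\<rfloor>" by (simp only: zero_le_floor)
    then have "real (cell n (center n u) s) = of_int \<lfloor>?c + real n * s\<rfloor>"
      unfolding cell_def by (rule of_nat_nat)
    then have near: "real (cell n (center n u) s) \<le> ?c + real n * s" "?c + real n * s < real (cell n (center n u) s) + 1"
      using floor_correct[of "?c + real n * s"] by linarith+
    have "\<bar>real (cell n (center n u) s) - real n ^ 2 * u / 2\<bar> \<le> (\<bar>s\<bar> + 2) * real n"
    proof -
      have "(\<bar>s\<bar> + 2) * real n = real n * \<bar>s\<bar> + 2 * real n" by (simp add: algebra_simps)
      moreover have "real n * s \<le> real n * \<bar>s\<bar>" "- (real n * s) \<le> real n * \<bar>s\<bar>"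
        using s by linarith+
      moreover have "real n ^ 2 * u / 2 - 1 \<le> ?c" "?c \<le> real n ^ 2 * u / 2" using cb u by auto
      ultimately show ?thesis
        using n near by linarith
    qed
    then show ?case using elim(1) by blast
  qed
qed

text \<open>
  The mean \<open>- 1 / (1 - u) / D\<close> of the limit is the shift caused by the slope at the center, and \<open>1 / sqrt D\<close> is the
  standard deviation on the scale \<open>(k - c) / n\<close>.
\<close>

lemma window_average_limit:
  fixes \<psi> :: "real \<Rightarrow> real" and \<psi>' :: "nat \<Rightarrow> real \<Rightarrow> real"
  assumes \<delta>: "0 < \<delta>" "\<delta> < 1" and \<alpha>: "\<alpha> > 0" and u: "0 < u" "u < 1"
    and crit: "ln u - ln (1 - u) - \<alpha> * u\<^sup>2 = h"
    and D: "D = 2 / u + 2 / (1 - u) - 4 * \<alpha> * u" "D > 0"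
    and \<psi>: "\<psi> \<in> borel_measurable borel"
      "\<And>n x. \<bar>\<psi>' n x\<bar> \<le> C * (1 + \<bar>x\<bar>)"
      "AE s in lborel. \<forall>t. t \<longlonglongrightarrow> s \<longrightarrow> (\<lambda>n. \<psi>' n (t n)) \<longlonglongrightarrow> \<psi> s"
  shows "(\<lambda>n. (\<Sum>k\<in>window n \<delta> u. weight n \<alpha> h k * \<psi>' n ((real k - real (center n u)) / real n)) /
      (\<Sum>k\<in>window n \<delta> u. weight n \<alpha> h k))
    \<longlonglongrightarrow> (\<integral>s. normal_density (- 1 / (1 - u) / D) (1 / sqrt D) s * \<psi> s \<partial>lborel)"
proof -
  define \<beta> where "\<beta> = - 1 / (1 - u)"
  define c where "c n = center n u" for n
  define K where "K n = window n \<delta> u" for n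
  define F where "F n k = ln (weight n \<alpha> h k)" for n k
  define \<eta> where "\<eta> n = real n powr - \<delta>" for n
  define b where "b n = real n * (F n (Suc (c n)) - F n (c n))" for n
  define L where "L n = 2 / (u + \<eta> n) + 2 / (1 - u + \<eta> n) - 4 * \<alpha> * (u + \<eta> n)" for n
  define U where "U n = 2 / (u - \<eta> n) + 2 / (1 - 1 / real n - u - \<eta> n) - 4 * \<alpha> * (u - \<eta> n)" for n
  define Z where "Z = exp (\<beta>\<^sup>2 / (2 * D)) * sqrt (2 * pi / D)"
  have Z: "Z > 0" using D by (simp add: Z_def)
  have \<eta>0: "\<eta> \<longlonglongrightarrow> 0"
    unfolding \<eta>_def using \<delta> by (intro tendsto_neg_powr filterlim_real_sequentially) auto
  have inv: "(\<lambda>n. 1 / real n) \<longlonglongrightarrow> 0" by (rule lim_1_over_n)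
  have L: "L \<longlonglongrightarrow> D"
  proof -
    have "L \<longlonglongrightarrow> 2 / (u + 0) + 2 / (1 - u + 0) - 4 * \<alpha> * (u + 0)"
      unfolding L_def by (intro tendsto_intros \<eta>0) (use u in auto)
    then show ?thesis by (simp add: D(1))
  qed
  have U: "U \<longlonglongrightarrow> D"
  proof -
    have "U \<longlonglongrightarrow> 2 / (u - 0) + 2 / (1 - 0 - u - 0) - 4 * \<alpha> * (u - 0)"
      unfolding U_def by (intro tendsto_intros \<eta>0 inv) (use u in auto)
    then show ?thesis by (simp add: D(1))
  qed
  have b: "b \<longlonglongrightarrow> \<beta>"
    unfolding b_def F_def c_def \<beta>_def by (rule center_slope_limit[OF u crit])
  have l1: "(\<lambda>n. u - \<eta> n) \<longlonglongrightarrow> u - 0" and l2: "(\<lambda>n. 1 - 1 / real n - u - \<eta> n) \<longlonglongrightarrow> 1 - 0 - u - 0"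
    by (intro tendsto_intros \<eta>0 inv)+
  have ev1: "eventually (\<lambda>n. u - \<eta> n > 0) sequentially"
      and ev2: "eventually (\<lambda>n. 1 - 1 / real n - u - \<eta> n > 0) sequentially"
    by (rule order_tendstoD(1)[OF l1], use u in simp) (rule order_tendstoD(1)[OF l2], use u in simp)
  have zero: "eventually (\<lambda>n. 0 \<notin> K n) sequentially"
    using ev1 by eventually_elim (use u in \<open>auto simp: K_def window_def \<eta>_def\<close>)
  have cK: "eventually (\<lambda>n. c n \<in> K n \<and> Suc (c n) \<in> K n) sequentially"
    using eventually_in_window[OF \<delta> u, of 1] eventually_gt_at_top[of 0]
  proof eventually_elim
    case (elim n)
    have "real n \<ge> 1" using elim by simp
    then show ?case
      using elim(1) center_bounds[of u n] u unfolding c_def K_def by (auto simp: abs_le_iff)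
  qed
  have good: "eventually (\<lambda>n. n > 0 \<and> u - \<eta> n > 0 \<and> 1 - 1 / real n - u - \<eta> n > 0
      \<and> c n \<in> K n \<and> Suc (c n) \<in> K n) sequentially"
    using ev1 ev2 cK eventually_gt_at_top[of 0] by eventually_elim auto
  have upper: "eventually (\<lambda>n. \<forall>k\<in>K n. F n k - F n (c n) \<le>
        (real k - real (c n)) / real n * b n
        - L n * ((real k - real (c n)) / real n * ((real k - real (c n)) / real n - 1 / real n) / 2)) sequentially"
    using good
  proof eventually_elim
    case (elim n)
    then show ?case
      using window_log_weight_bounds(1)[of n \<alpha> u \<delta> _ h] \<alpha>
      unfolding F_def c_def K_def b_def L_def \<eta>_def by blast
  qed
  have lower: "eventually (\<lambda>n. \<forall>k\<in>K n.
        (real k - real (c n)) / real n * b n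
        - U n * ((real k - real (c n)) / real n * ((real k - real (c n)) / real n - 1 / real n) / 2)
        \<le> F n k - F n (c n)) sequentially"
    using good
  proof eventually_elim
    case (elim n)
    then show ?case
      using window_log_weight_bounds(2)[of n \<alpha> u \<delta> _ h] \<alpha>
      unfolding F_def c_def K_def b_def U_def \<eta>_def by blast
  qed
  have finK: "finite (K n)" for n unfolding K_def by (rule finite_window)
  have wide: "eventually (\<lambda>n. cell n (c n) s \<in> K n) sequentially" for s
    unfolding c_def K_def by (rule eventually_cell_in_window[OF \<delta> u])
  have gauss: "(\<integral>s. exp (\<beta> * s - D * s\<^sup>2 / 2) * \<phi> s \<partial>lborel) =
      Z * (\<integral>s. normal_density (\<beta> / D) (1 / sqrt D) s * \<phi> s \<partial>lborel)" for \<phi> :: "real \<Rightarrow> real"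
    unfolding exp_quadratic_normal_density[OF D(2)] Z_def[symmetric]
    by (simp add: mult.assoc)
  have num: "(\<lambda>n. (\<Sum>k\<in>K n. exp (F n k - F n (c n)) * \<psi>' n ((real k - real (c n)) / real n)) / real n)
      \<longlonglongrightarrow> Z * (\<integral>s. normal_density (\<beta> / D) (1 / sqrt D) s * \<psi> s \<partial>lborel)"
    using Laplace_sum_limit[OF finK zero wide b L U D(2) upper lower \<psi>] unfolding gauss .
  have "(\<lambda>n. (\<Sum>k\<in>K n. exp (F n k - F n (c n)) * 1) / real n)
      \<longlonglongrightarrow> Z * (\<integral>s. normal_density (\<beta> / D) (1 / sqrt D) s * 1 \<partial>lborel)"
    unfolding gauss[symmetric]
    by (rule Laplace_sum_limit[OF finK zero wide b L U D(2) upper lower,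
          where \<psi>' = "\<lambda>_ _. 1" and \<psi> = "\<lambda>_. 1" and C = 1]) auto
  then have den: "(\<lambda>n. (\<Sum>k\<in>K n. exp (F n k - F n (c n))) / real n) \<longlonglongrightarrow> Z"
    using D by simp
  have "(\<lambda>n. ((\<Sum>k\<in>K n. exp (F n k - F n (c n)) * \<psi>' n ((real k - real (c n)) / real n)) / real n) /
        ((\<Sum>k\<in>K n. exp (F n k - F n (c n))) / real n))
      \<longlonglongrightarrow> Z * (\<integral>s. normal_density (\<beta> / D) (1 / sqrt D) s * \<psi> s \<partial>lborel) / Z"
    using Z by (intro tendsto_divide num den) auto
  then have "(\<lambda>n. ((\<Sum>k\<in>K n. exp (F n k - F n (c n)) * \<psi>' n ((real k - real (c n)) / real n)) / real n) /
        ((\<Sum>k\<in>K n. exp (F n k - F n (c n))) / real n))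
      \<longlonglongrightarrow> (\<integral>s. normal_density (\<beta> / D) (1 / sqrt D) s * \<psi> s \<partial>lborel)"
    using Z by simp
  then show ?thesis
    unfolding \<beta>_def[symmetric]
  proof (rule Lim_transform_eventually)
    show "eventually (\<lambda>n. ((\<Sum>k\<in>K n. exp (F n k - F n (c n)) * \<psi>' n ((real k - real (c n)) / real n)) / real n) /
        ((\<Sum>k\<in>K n. exp (F n k - F n (c n))) / real n) =
      (\<Sum>k\<in>window n \<delta> u. weight n \<alpha> h k * \<psi>' n ((real k - real (center n u)) / real n)) /
      (\<Sum>k\<in>window n \<delta> u. weight n \<alpha> h k)) sequentially"
      using eventually_gt_at_top[of 0]
    proof eventually_elim
      case (elim n)
      have w: "exp (F n k - F n (c n)) = weight n \<alpha> h k * exp (- F n (c n))" if "k \<in> K n" for k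
        using weight_pos[of k n \<delta> u \<alpha> h] that by (simp add: F_def K_def exp_diff exp_minus divide_inverse)
      have "(\<Sum>k\<in>K n. exp (F n k - F n (c n)) * \<psi>' n ((real k - real (c n)) / real n)) =
          exp (- F n (c n)) * (\<Sum>k\<in>K n. weight n \<alpha> h k * \<psi>' n ((real k - real (c n)) / real n))"
        unfolding sum_distrib_left by (rule sum.cong) (auto simp: w)
      moreover have "(\<Sum>k\<in>K n. exp (F n k - F n (c n))) = exp (- F n (c n)) * (\<Sum>k\<in>K n. weight n \<alpha> h k)"
        unfolding sum_distrib_left by (rule sum.cong) (auto simp: w)
      ultimately show ?case using elim by (simp add: K_def c_def)
    qed
  qed
qed

section \<open>The limit theorems\<close>

lemma expectation_P_hat_limit:
  fixes \<delta> \<alpha> h D :: real and i :: nat and \<psi> :: "real \<Rightarrow> real" and \<psi>' :: "nat \<Rightarrow> real \<Rightarrow> real"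
  assumes \<delta>: "0 < \<delta>" "\<delta> < 1" and \<alpha>: "\<alpha> > 0"
  defines "u \<equiv> ustar i \<alpha> h"
  assumes u: "0 < u" "u < 1"
    and crit: "ln u - ln (1 - u) - \<alpha> * u\<^sup>2 = h"
    and D: "D = 2 / u + 2 / (1 - u) - 4 * \<alpha> * u" "D > 0"
    and \<psi>: "\<psi> \<in> borel_measurable borel"
      "\<And>n x. \<bar>\<psi>' n x\<bar> \<le> C * (1 + \<bar>x\<bar>)"
      "AE s in lborel. \<forall>t. t \<longlonglongrightarrow> s \<longrightarrow> (\<lambda>n. \<psi>' n (t n)) \<longlonglongrightarrow> \<psi> s"
    and ne: "eventually (\<lambda>n. cond_event i \<delta> n \<alpha> h \<noteq> {}) sequentially"
  shows "(\<lambda>n. \<integral>x. \<psi>' n ((S n x - real (center n u)) / real n) \<partial>P_hat i \<delta> n \<alpha> h)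
    \<longlonglongrightarrow> (\<integral>s. normal_density (- 1 / (1 - u) / D) (1 / sqrt D) s * \<psi> s \<partial>lborel)"
proof (rule Lim_transform_eventually[OF window_average_limit[OF \<delta> \<alpha> u crit D \<psi>]])
  show "eventually (\<lambda>n. (\<Sum>k\<in>window n \<delta> u. weight n \<alpha> h k * \<psi>' n ((real k - real (center n u)) / real n)) /
      (\<Sum>k\<in>window n \<delta> u. weight n \<alpha> h k) =
      (\<integral>x. \<psi>' n ((S n x - real (center n u)) / real n) \<partial>P_hat i \<delta> n \<alpha> h)) sequentially"
    using ne
  proof eventually_elim
    case (elim n)
    show ?case
      unfolding u_def
      by (rule integral_P_hat[OF elim, of "\<lambda>s. \<psi>' n ((s - real (center n (ustar i \<alpha> h))) / real n)", symmetric])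
  qed
qed

text \<open>
  On the scale \<open>(k - c) / n\<close> the centering by \<open>m_hat\<close> is a convergent sequence of shifts.
\<close>

lemma m_hat_centered:
  assumes ne: "cond_event i \<delta> n \<alpha> h \<noteq> {}" and n: "n > 0"
  shows "(\<integral>x. (S n x - c) / real n \<partial>P_hat i \<delta> n \<alpha> h) = (real n ^ 2 / 2 * m_hat i \<delta> n \<alpha> h - c) / real n"
proof -
  let ?K = "window n \<delta> (ustar i \<alpha> h)" and ?w = "weight n \<alpha> h"
  have "?K \<noteq> {}"
  proof
    assume "?K = {}"
    then have "(\<Sum>x\<in>cond_event i \<delta> n \<alpha> h. exp (hamiltonian n \<alpha> h x)) = 0"
      using sum_cond_event[where g = "\<lambda>_. 1" and i = i and n = n and \<alpha> = \<alpha> and h = h and \<delta> = \<delta>] by simp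
    moreover have "finite (cond_event i \<delta> n \<alpha> h)"
      by (rule finite_subset[OF _ finite_configs]) (auto simp: cond_event_def)
    ultimately show False using ne by (subst (asm) sum_nonneg_eq_0_iff) auto
  qed
  then have W: "sum ?w ?K > 0" by (intro sum_pos finite_window weight_pos) auto
  have "(\<Sum>k\<in>?K. ?w k * ((real k - c) / real n)) = ((\<Sum>k\<in>?K. ?w k * real k) - sum ?w ?K * c) / real n"
    by (simp add: right_diff_distrib diff_divide_distrib sum_subtractf sum_divide_distrib sum_distrib_right)
  then have 1: "(\<integral>x. (S n x - c) / real n \<partial>P_hat i \<delta> n \<alpha> h) =
      ((\<Sum>k\<in>?K. ?w k * real k) / sum ?w ?K - c) / real n"
    using integral_P_hat[OF ne, of "\<lambda>s. (s - c) / real n"] W by (simp add: diff_divide_distrib)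
  have "(\<Sum>k\<in>?K. ?w k * (2 * real k / real n ^ 2)) = 2 / real n ^ 2 * (\<Sum>k\<in>?K. ?w k * real k)"
    unfolding sum_distrib_left by (intro sum.cong) auto
  then have "m_hat i \<delta> n \<alpha> h = 2 / real n ^ 2 * (\<Sum>k\<in>?K. ?w k * real k) / sum ?w ?K"
    unfolding m_hat_def using integral_P_hat[OF ne, of "\<lambda>s. 2 * s / real n ^ 2"] by simp
  then have "real n ^ 2 / 2 * m_hat i \<delta> n \<alpha> h = (\<Sum>k\<in>?K. ?w k * real k) / sum ?w ?K"
    using n by simp
  with 1 show ?thesis by simp
qed

lemma eventually_cond_event_nonempty:
  assumes \<delta>: "0 < \<delta>" "\<delta> < 1" and u: "0 < ustar i \<alpha> h" "ustar i \<alpha> h < 1"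
  shows "eventually (\<lambda>n. cond_event i \<delta> n \<alpha> h \<noteq> {}) sequentially"
  using eventually_cell_in_window[OF \<delta> u, of 0]
proof eventually_elim
  case (elim n)
  have "sum (weight n \<alpha> h) (window n \<delta> (ustar i \<alpha> h)) > 0"
    using elim by (intro sum_pos finite_window weight_pos) auto
  then show ?case
    using sum_cond_event[where g = "\<lambda>_. 1" and i = i and n = n and \<alpha> = \<alpha> and h = h and \<delta> = \<delta>] by auto
qed

lemma borel_measurable_P_hat [measurable]: "f \<in> borel_measurable (P_hat i \<delta> n \<alpha> h)"
  for f :: "_ \<Rightarrow> real"
proof -
  have "sets (P_hat i \<delta> n \<alpha> h) = sets (count_space (configs n))"
    by (simp add: P_hat_def uniform_measure_def mf_measure_def sets_point_measure)
  then show ?thesis using measurable_cong_sets[of "P_hat i \<delta> n \<alpha> h" "count_space (configs n)" borel borel] by auto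
qed

lemma AE_P_hat:
  assumes ne: "cond_event i \<delta> n \<alpha> h \<noteq> {}"
  shows "AE x in P_hat i \<delta> n \<alpha> h. x \<in> cond_event i \<delta> n \<alpha> h"
  unfolding P_hat_eq_point_measure[OF ne]
  by (auto simp: AE_point_measure indicator_def split: if_splits)

text \<open>
  The conditioning event itself forces the edge density to be within \<open>n powr - \<delta>\<close> of the maximizer, whatever the joint
  law of the variables; only countably many null sets have to be discarded.
\<close>

lemma strong_law_on_joint_realization:
  assumes \<delta>: "0 < \<delta>" "\<delta> < 1" and u: "0 < ustar i \<alpha> h" "ustar i \<alpha> h < 1"
    and J: "joint_realization i \<delta> \<alpha> h M T"
  shows "AE \<omega> in M. (\<lambda>n. 2 * T n \<omega> / real n ^ 2) \<longlonglongrightarrow> ustar i \<alpha> h"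
proof -
  let ?u = "ustar i \<alpha> h"
  have T: "\<And>n. T n \<in> borel_measurable M"
    and law: "\<And>n. cond_event i \<delta> n \<alpha> h \<noteq> {} \<Longrightarrow> distr M borel (T n) = distr (P_hat i \<delta> n \<alpha> h) borel (S n)"
    using J by (auto simp: joint_realization_def)
  have close: "AE \<omega> in M. cond_event i \<delta> n \<alpha> h \<noteq> {} \<longrightarrow> \<bar>2 * T n \<omega> / real n ^ 2 - ?u\<bar> \<le> real n powr - \<delta>" for n
  proof (cases "cond_event i \<delta> n \<alpha> h = {}")
    case False
    let ?B = "{t::real. \<bar>2 * t / real n ^ 2 - ?u\<bar> \<le> real n powr - \<delta>}"
    have B: "?B \<in> sets borel" by measurable
    have "AE x in P_hat i \<delta> n \<alpha> h. S n x \<in> ?B"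
      using AE_P_hat[OF False] by (rule eventually_mono) (auto simp: cond_event_eq)
    then have "AE t in distr (P_hat i \<delta> n \<alpha> h) borel (S n). t \<in> ?B"
      using B by (subst AE_distr_iff) auto
    then have "AE t in distr M borel (T n). t \<in> ?B" unfolding law[OF False] .
    then have "AE \<omega> in M. T n \<omega> \<in> ?B"
      using B T by (subst (asm) AE_distr_iff) auto
    then show ?thesis by (rule eventually_mono) auto
  qed simp
  have ne: "eventually (\<lambda>n. cond_event i \<delta> n \<alpha> h \<noteq> {}) sequentially"
    by (rule eventually_cond_event_nonempty[OF \<delta> u])
  have \<eta>: "(\<lambda>n. real n powr - \<delta>) \<longlonglongrightarrow> 0"
    using \<delta> by (intro tendsto_neg_powr filterlim_real_sequentially) auto
  have "AE \<omega> in M. \<forall>n. cond_event i \<delta> n \<alpha> h \<noteq> {} \<longrightarrow> \<bar>2 * T n \<omega> / real n ^ 2 - ?u\<bar> \<le> real n powr - \<delta>"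
    using close by (simp add: AE_all_countable)
  then show ?thesis
  proof (rule eventually_mono)
    fix \<omega> assume *: "\<forall>n. cond_event i \<delta> n \<alpha> h \<noteq> {} \<longrightarrow> \<bar>2 * T n \<omega> / real n ^ 2 - ?u\<bar> \<le> real n powr - \<delta>"
    have "eventually (\<lambda>n. norm (2 * T n \<omega> / real n ^ 2 - ?u) \<le> real n powr - \<delta>) sequentially"
      using ne by eventually_elim (use * in simp)
    then have "(\<lambda>n. 2 * T n \<omega> / real n ^ 2 - ?u) \<longlonglongrightarrow> 0"
      by (rule Lim_null_comparison[OF _ \<eta>])
    then show "(\<lambda>n. 2 * T n \<omega> / real n ^ 2) \<longlonglongrightarrow> ?u" by (rule LIM_zero_cancel)
  qed
qed

text \<open>
  Substitute \<open>y = sqrt 2 * (s - \<mu>)\<close>.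
\<close>

lemma cdf_normal_affine:
  fixes \<mu> x v :: real
  assumes v: "v > 0"
  shows "cdf (density lborel (normal_density 0 (sqrt v))) x =
    (\<integral>s. normal_density \<mu> (sqrt (v / 2)) s * indicator {..x / sqrt 2 + \<mu>} s \<partial>lborel)"
proof -
  let ?M = "density lborel (normal_density 0 (sqrt v))"
  have pos: "sqrt v > 0" using v by simp
  interpret prob_space ?M by (rule prob_space_normal_density[OF pos])
  have "cdf ?M x = (\<integral>y. indicator {..x} y \<partial>?M)"
    by (simp add: cdf_def)
  also have "\<dots> = (\<integral>y. normal_density 0 (sqrt v) y * indicator {..x} y \<partial>lborel)"
    by (subst integral_density) auto
  also have "\<dots> = \<bar>sqrt 2\<bar> *\<^sub>R (\<integral>s. normal_density 0 (sqrt v) (- sqrt 2 * \<mu> + sqrt 2 * s) *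
      indicator {..x} (- sqrt 2 * \<mu> + sqrt 2 * s) \<partial>lborel)"
    by (rule lborel_integral_real_affine) simp
  also have "\<dots> = (\<integral>s. sqrt 2 * (normal_density 0 (sqrt v) (- sqrt 2 * \<mu> + sqrt 2 * s) *
      indicator {..x} (- sqrt 2 * \<mu> + sqrt 2 * s)) \<partial>lborel)"
    by simp
  also have "\<dots> = (\<integral>s. normal_density \<mu> (sqrt (v / 2)) s * indicator {..x / sqrt 2 + \<mu>} s \<partial>lborel)"
  proof (rule Bochner_Integration.integral_cong[OF refl])
    fix s
    have eq: "- sqrt 2 * \<mu> + sqrt 2 * s = sqrt 2 * (s - \<mu>)" by (simp add: algebra_simps)
    have "sqrt 2 * (s - \<mu>) \<le> x \<longleftrightarrow> s \<le> x / sqrt 2 + \<mu>"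
      by (simp add: pos_le_divide_eq mult.commute flip: le_diff_eq) (simp add: field_simps)
    then have ind: "indicator {..x} (sqrt 2 * (s - \<mu>)) = (indicator {..x / sqrt 2 + \<mu>} s :: real)"
      by (simp add: indicator_def)
    have nd0: "normal_density 0 (sqrt v) (sqrt 2 * (s - \<mu>)) = 1 / sqrt (2 * pi * v) * exp (- (s - \<mu>)\<^sup>2 / v)"
      using v by (simp add: normal_density_def power_mult_distrib)
    have nd1: "normal_density \<mu> (sqrt (v / 2)) s = 1 / sqrt (pi * v) * exp (- (s - \<mu>)\<^sup>2 / v)"
      using v by (simp add: normal_density_def)
    have "sqrt 2 * (1 / sqrt (2 * pi * v)) = 1 / sqrt (pi * v)"
      using v by (simp add: real_sqrt_mult)
    then have "sqrt 2 * normal_density 0 (sqrt v) (sqrt 2 * (s - \<mu>)) = normal_density \<mu> (sqrt (v / 2)) s"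
      unfolding nd0 nd1 by (simp only: mult.assoc[symmetric])
    then show "sqrt 2 * (normal_density 0 (sqrt v) (- sqrt 2 * \<mu> + sqrt 2 * s) *
        indicator {..x} (- sqrt 2 * \<mu> + sqrt 2 * s)) =
        normal_density \<mu> (sqrt (v / 2)) s * indicator {..x / sqrt 2 + \<mu>} s"
      unfolding eq ind by (simp flip: mult.assoc)
  qed
  finally show ?thesis .
qed

lemma indicator_atMost_continuous_convergence:
  fixes a :: "nat \<Rightarrow> real"
  assumes "a \<longlonglongrightarrow> a0" "t \<longlonglongrightarrow> s" "s \<noteq> a0"
  shows "(\<lambda>n. indicator {..a n} (t n) :: real) \<longlonglongrightarrow> indicator {..a0} s"
proof (cases "s < a0")
  case True
  have "eventually (\<lambda>n. t n - a n < 0) sequentially"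
    using tendsto_diff[OF assms(2,1)] by (rule order_tendstoD) (use True in simp)
  then have "eventually (\<lambda>n. indicator {..a n} (t n) = (indicator {..a0} s :: real)) sequentially"
    by eventually_elim (use True in simp)
  then show ?thesis by (rule tendsto_eventually)
next
  case False
  have "eventually (\<lambda>n. t n - a n > 0) sequentially"
    using tendsto_diff[OF assms(2,1)] by (rule order_tendstoD) (use False assms(3) in simp)
  then have "eventually (\<lambda>n. indicator {..a n} (t n) = (indicator {..a0} s :: real)) sequentially"
    by eventually_elim (use False assms(3) in simp)
  then show ?thesis by (rule tendsto_eventually)
qed

text \<open>
  The distribution function at \<open>x\<close> is the expectation of an indicator with a threshold that depends on \<open>n\<close>
  through the mean.  The mean converges by the limit theorem for the identity test function, so the indicators converge
  continuously at every point but the limiting threshold, and the same theorem applies to them.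
\<close>

lemma central_limit_P_hat:
  assumes \<delta>: "0 < \<delta>" "\<delta> < 1" and \<alpha>: "\<alpha> > 0"
    and u: "0 < ustar i \<alpha> h" "ustar i \<alpha> h < 1"
    and crit: "ln (ustar i \<alpha> h) - ln (1 - ustar i \<alpha> h) - \<alpha> * (ustar i \<alpha> h)\<^sup>2 = h"
    and nondeg: "2 * \<alpha> * ((ustar i \<alpha> h)\<^sup>2 * (1 - ustar i \<alpha> h)) < 1"
  shows "weak_conv_m
           (\<lambda>n. distr (P_hat i \<delta> n \<alpha> h) borel
                  (\<lambda>x. sqrt 2 * (S n x - real n ^ 2 / 2 * m_hat i \<delta> n \<alpha> h) / real n))
           (density lborel (normal_density 0 (sqrt (variance_v i \<alpha> h))))"
proof -
  define w where "w = ustar i \<alpha> h"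
  define v where "v = variance_v i \<alpha> h"
  define D where "D = 2 / w + 2 / (1 - w) - 4 * \<alpha> * w"
  define \<mu> where "\<mu> = - 1 / (1 - w) / D"
  define c where "c n = real (center n w)" for n
  define Y where "Y n x = (S n x - c n) / real n" for n x
  define d where "d n = (real n ^ 2 / 2 * m_hat i \<delta> n \<alpha> h - c n) / real n" for n
  have v_eq: "v = w * (1 - w) / (1 - 2 * \<alpha> * (w\<^sup>2 * (1 - w)))"
    by (simp add: v_def variance_v_def w_def mult.assoc)
  have v: "v > 0" unfolding v_eq using u nondeg by (simp add: w_def)
  have Dv: "D = 2 / v"
    using u unfolding v_eq D_def w_def[symmetric] by (simp add: field_simps power2_eq_square)
  have D: "D > 0" using v Dv by simp
  have \<sigma>: "1 / sqrt D = sqrt (v / 2)" using v by (simp add: Dv real_sqrt_divide)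
  have ne: "eventually (\<lambda>n. cond_event i \<delta> n \<alpha> h \<noteq> {}) sequentially"
    by (rule eventually_cond_event_nonempty[OF \<delta> u])
  note limit = expectation_P_hat_limit[OF \<delta> \<alpha> u crit D_def[unfolded w_def] D _ _ _ ne,
      folded w_def, folded c_def \<mu>_def, folded Y_def, unfolded \<sigma>]
  have "(\<lambda>n. \<integral>x. Y n x \<partial>P_hat i \<delta> n \<alpha> h) \<longlonglongrightarrow> (\<integral>s. normal_density \<mu> (sqrt (v / 2)) s * s \<partial>lborel)"
    by (rule limit[where \<psi>' = "\<lambda>_ x. x" and \<psi> = "\<lambda>x. x" and C = 1]) auto
  then have EY: "(\<lambda>n. \<integral>x. Y n x \<partial>P_hat i \<delta> n \<alpha> h) \<longlonglongrightarrow> \<mu>"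
    using v by (simp add: integral_normal_moment_nz_1)
  have d: "d \<longlonglongrightarrow> \<mu>"
  proof (rule Lim_transform_eventually[OF EY])
    show "eventually (\<lambda>n. (\<integral>x. Y n x \<partial>P_hat i \<delta> n \<alpha> h) = d n) sequentially"
      using ne eventually_gt_at_top[of 0]
    proof eventually_elim
      case (elim n)
      show ?case unfolding Y_def d_def by (rule m_hat_centered[OF elim])
    qed
  qed
  show ?thesis
    unfolding weak_conv_m_def weak_conv_def
  proof (intro allI impI)
    fix x :: real
    let ?a = "\<lambda>n. x / sqrt 2 + d n" and ?l = "x / sqrt 2 + \<mu>"
    have a: "?a \<longlonglongrightarrow> ?l" by (intro tendsto_intros d)
    have "(\<lambda>n. \<integral>y. indicator {..?a n} (Y n y) \<partial>P_hat i \<delta> n \<alpha> h)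
        \<longlonglongrightarrow> (\<integral>s. normal_density \<mu> (sqrt (v / 2)) s * indicator {..?l} s \<partial>lborel)"
    proof (rule limit[where \<psi>' = "\<lambda>n. indicator {..?a n}" and \<psi> = "indicator {..?l}" and C = 1])
      show "\<bar>indicator {..?a n} y :: real\<bar> \<le> 1 * (1 + \<bar>y\<bar>)" for n y
        by (simp add: indicator_def)
      show "AE s in lborel. \<forall>t. t \<longlonglongrightarrow> s \<longrightarrow> (\<lambda>n. indicator {..?a n} (t n) :: real) \<longlonglongrightarrow> indicator {..?l} s"
        using AE_lborel_singleton[of ?l]
        by (rule eventually_mono) (use indicator_atMost_continuous_convergence[OF a] in blast)
    qed simp
    moreover have "eventually (\<lambda>n. (\<integral>y. indicator {..?a n} (Y n y) \<partial>P_hat i \<delta> n \<alpha> h) =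
        cdf (distr (P_hat i \<delta> n \<alpha> h) borel
          (\<lambda>x. sqrt 2 * (S n x - real n ^ 2 / 2 * m_hat i \<delta> n \<alpha> h) / real n)) x) sequentially"
      using ne eventually_gt_at_top[of 0]
    proof eventually_elim
      case (elim n)
      let ?f = "\<lambda>x. sqrt 2 * (S n x - real n ^ 2 / 2 * m_hat i \<delta> n \<alpha> h) / real n"
      let ?P = "P_hat i \<delta> n \<alpha> h"
      have f: "?f y = sqrt 2 * (Y n y - d n)" for y
        by (simp add: Y_def d_def diff_divide_distrib right_diff_distrib)
      have le: "?f y \<le> x \<longleftrightarrow> Y n y \<le> ?a n" for y
        unfolding f by (simp add: field_simps)
      interpret prob_space ?P by (rule prob_space_P_hat[OF elim(1)])
      have "cdf (distr ?P borel ?f) x = measure ?P (?f -` {..x} \<inter> space ?P)"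
        unfolding cdf_def by (rule measure_distr) auto
      also have "\<dots> = (\<integral>y. indicator (?f -` {..x} \<inter> space ?P) y \<partial>?P)"
        by simp
      also have "\<dots> = (\<integral>y. indicator {..?a n} (Y n y) \<partial>?P)"
        by (rule Bochner_Integration.integral_cong[OF refl]) (use le in \<open>auto simp: indicator_def\<close>)
      finally show ?case by simp
    qed
    ultimately show "(\<lambda>n. cdf (distr (P_hat i \<delta> n \<alpha> h) borel
          (\<lambda>x. sqrt 2 * (S n x - real n ^ 2 / 2 * m_hat i \<delta> n \<alpha> h) / real n)) x)
        \<longlonglongrightarrow> cdf (density lborel (normal_density 0 (sqrt (variance_v i \<alpha> h)))) x"
      unfolding v_def[symmetric] cdf_normal_affine[OF v, of x \<mu>]
      by (rule Lim_transform_eventually)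
  qed
qed

theorem theorem9p12:
  fixes \<delta> \<alpha> h :: real and i :: nat
  assumes "0 < \<delta>" and "\<delta> < 1"
    and "i \<in> {1, 2}"
    and "(\<alpha>, h) \<in> M_rs"
  shows "(\<forall>(M :: 'w measure) T. joint_realization i \<delta> \<alpha> h M T \<longrightarrow>
            (AE \<omega> in M. (\<lambda>n. 2 * T n \<omega> / real n ^ 2) \<longlonglongrightarrow> ustar i \<alpha> h)) \<and>
         weak_conv_m
           (\<lambda>n. distr (P_hat i \<delta> n \<alpha> h) borel
                  (\<lambda>x. sqrt 2 * (S n x - real n ^ 2 / 2 * m_hat i \<delta> n \<alpha> h) / real n))
           (density lborel (normal_density 0 (sqrt (variance_v i \<alpha> h))))"
proof -
  have \<alpha>: "\<alpha> > 27 / 8" using assms(4) by (simp add: M_rs_def \<alpha>_crit_def)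
  then have pos: "\<alpha> > 0" by simp
  note max = ustar_in_maximizers[OF \<alpha>, of i h]
  note u = maximizer_interior[OF pos max]
  show ?thesis
    using strong_law_on_joint_realization[OF assms(1,2) u]
      central_limit_P_hat[OF assms(1,2) pos u maximizer_critical[OF pos max, unfolded critical_field_def]
        maximizer_nondegenerate[OF \<alpha> max]]
    by blast
qed

end
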